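(* (Automorphism Splitting Theorem) Let $\Gamma$ be a connected finite simple graph with first Betti number $b_1\geq 2$ such that $\mathcal{H}^0(F(\Gamma))$ is trivial. Then \[\mathrm{Aut}(\Gamma)\cong\ker(\phi^1_\Gamma)\times\mathcal{H}^1(\Gamma),\] where the elements of $\ker(\phi^1_\Gamma)$ correspond to the automorphisms of $\Gamma$ that fix $\mathrm{Cyc}(\Gamma)$ pointwise, and the elements of $\mathcal{H}^1(\Gamma)$ correspond to the automorphisms of $\Gamma$ that fix $F(\Gamma)$ pointwise.
   Context: $b_1$ is the number of independent cycles. Cycle-forest decomposition: let $F_1$ be the set of leaves (degree-1 vertices) of $\Gamma$, and recursively let $F_j$ be the set of leaves of $\Gamma-\bigcup_{i<j}F_i$ (removing vertices with their incident edges), until $F_j=\emptyset$ for all $j>k$. $F(\Gamma)$ is the subgraph consisting of the vertices of $\bigcup_{i=1}^kF_i$ together with all edges of $\Gamma$ incident to them (and their endpoints); $\mathrm{Cyc}(\Gamma)=\Gamma-\bigcup_{i=1}^kF_i$. For a graph $X$: $H^0(X)$ is the space of real vertex functions constant on connected components, $\Omega^1(X)$ the space of real functions $f$ on ordered pairs of adjacent vertices with $f(v,w)=-f(w,v)$, $D$ maps a vertex function $u$ to $Du(v,w)=u(w)-u(v)$, and $H^1(X)=\Omega^1(X)/\mathrm{Im}(D)$. Each $g\in\mathrm{Aut}(X)$ acts on $H^0(X)$ and $H^1(X)$ by pullback ($g^*u(v)=u(g(v))$, $g^*f(v,w)=f(g(v),g(w))$); $\phi^i_X(g)=(g^* )^{-1}$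 on $H^i(X)$, and $\mathcal{H}^i(X)$ is the image of $\phi^i_X$, $i=0,1$. *)

theory Defs
  imports
    Complex_Main
    "HOL-Library.Function_Algebras"
    "HOL-Algebra.Bij"
    "HOL-Algebra.Elementary_Groups"
    "Graph_Theory.Digraph_Component"
begin

text \<open>
  A finite simple graph is a \<open>pair_graph\<close>: a finite vertex set \<open>pverts\<close> with a symmetric irreflexive
  set \<open>parcs\<close> of ordered pairs of adjacent vertices.
\<close>

section \<open>Cycle-forest decomposition\<close>

definition minus_verts :: "'a pair_pre_digraph \<Rightarrow> 'a set \<Rightarrow> 'a pair_pre_digraph" where
  "minus_verts X S =
     \<lparr> pverts = pverts X - S, parcs = {(v, w) \<in> parcs X. v \<notin> S \<and> w \<notin> S} \<rparr>"

text \<open>By symmetry of \<open>parcs\<close>, the out-degree is the degree of the undirected graph.\<close>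

definition leaves :: "'a pair_pre_digraph \<Rightarrow> 'a set" where
  "leaves X = {v \<in> pverts X. out_degree (with_proj X) v = 1}"

text \<open>The layers are numbered from \<open>0\<close>: \<open>leaf_layer X j\<close> is \<open>F\<^sub>j\<^sub>+\<^sub>1\<close>.\<close>

fun leaf_layer :: "'a pair_pre_digraph \<Rightarrow> nat \<Rightarrow> 'a set" where
  "leaf_layer X j = leaves (minus_verts X (\<Union>i\<in>{..<j}. leaf_layer X i))"

declare leaf_layer.simps [simp del]

text \<open>In a finite graph all but finitely many layers are empty, so the union ranges over all \<open>j\<close>.\<close>

definition forest_verts :: "'a pair_pre_digraph \<Rightarrow> 'a set" where
  "forest_verts X = (\<Union>j. leaf_layer X j)"

definition Forest :: "'a pair_pre_digraph \<Rightarrow> 'a pair_pre_digraph" where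
  "Forest X =
     \<lparr> pverts = forest_verts X \<union> {w. \<exists>v \<in> forest_verts X. (v, w) \<in> parcs X},
       parcs = {(v, w) \<in> parcs X. v \<in> forest_verts X \<or> w \<in> forest_verts X} \<rparr>"

definition Cyc :: "'a pair_pre_digraph \<Rightarrow> 'a pair_pre_digraph" where
  "Cyc X = minus_verts X (forest_verts X)"


section \<open>First Betti number\<close>

definition fun_scale :: "real \<Rightarrow> ('b \<Rightarrow> real) \<Rightarrow> 'b \<Rightarrow> real" where
  "fun_scale c f = (\<lambda>x. c * f x)"

global_interpretation fun_vs: vector_space "fun_scale :: real \<Rightarrow> ('b \<Rightarrow> real) \<Rightarrow> 'b \<Rightarrow> real"
  by unfold_locales (simp_all add: fun_scale_def fun_eq_iff algebra_simps)

text \<open>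
  The oriented edge vector of a closed walk. The degenerate walks \<open>v, w, v\<close> of length two, which
  \<open>pre_digraph.cycle\<close> admits in a symmetric digraph, have vector zero.
\<close>

definition cycle_vec :: "('a \<times> 'a) list \<Rightarrow> 'a \<times> 'a \<Rightarrow> real" where
  "cycle_vec p = (\<lambda>(v, w). real (count_list p (v, w)) - real (count_list p (w, v)))"

text \<open>The maximal number of linearly independent cycles.\<close>

definition betti1 :: "'a pair_pre_digraph \<Rightarrow> nat" where
  "betti1 X = fun_vs.dim (cycle_vec ` {p. pre_digraph.cycle (with_proj X) p})"


section \<open>Automorphism group\<close>

definition automorphisms :: "'a pair_pre_digraph \<Rightarrow> ('a \<Rightarrow> 'a) set" where
  "automorphisms X =
     {g \<in> Bij (pverts X).
        \<forall>v \<in> pverts X. \<forall>w \<in> pverts X. (g v, g w) \<in> parcs X \<longleftrightarrow> (v, w) \<in> parcs X}"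

definition Aut :: "'a pair_pre_digraph \<Rightarrow> ('a \<Rightarrow> 'a) monoid" where
  "Aut X = (BijGroup (pverts X)) \<lparr> carrier := automorphisms X \<rparr>"

definition fixing :: "'a pair_pre_digraph \<Rightarrow> 'a set \<Rightarrow> ('a \<Rightarrow> 'a) set" where
  "fixing X S = {g \<in> automorphisms X. \<forall>v \<in> S. g v = v}"


section \<open>Cohomology\<close>

text \<open>
  Functions on the vertices (resp. on the ordered pairs of adjacent vertices) are represented by total
  functions vanishing elsewhere, so that the vector space operations are the pointwise ones.
\<close>

definition Omega0 :: "'a pair_pre_digraph \<Rightarrow> ('a \<Rightarrow> real) set" where
  "Omega0 X = {u. \<forall>v. v \<notin> pverts X \<longrightarrow> u v = 0}"

definition Omega1 :: "'a pair_pre_digraph \<Rightarrow> ('a \<times> 'a \<Rightarrow> real) set" where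
  "Omega1 X = {f. (\<forall>e. e \<notin> parcs X \<longrightarrow> f e = 0) \<and> (\<forall>(v, w) \<in> parcs X. f (v, w) = - f (w, v))}"

definition grad :: "'a pair_pre_digraph \<Rightarrow> ('a \<Rightarrow> real) \<Rightarrow> 'a \<times> 'a \<Rightarrow> real" where
  "grad X u = (\<lambda>(v, w). if (v, w) \<in> parcs X then u w - u v else 0)"

definition H0 :: "'a pair_pre_digraph \<Rightarrow> ('a \<Rightarrow> real) set" where
  "H0 X = {u \<in> Omega0 X. \<forall>v w. v \<rightarrow>\<^sup>*\<^bsub>with_proj X\<^esub> w \<longrightarrow> u v = u w}"

definition H1 :: "'a pair_pre_digraph \<Rightarrow> ('a \<times> 'a \<Rightarrow> real) set set" where
  "H1 X = Omega1 X // {(f, f'). f \<in> Omega1 X \<and> f' \<in> Omega1 X \<and> f - f' \<in> grad X ` Omega0 X}"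


section \<open>Action of the automorphism group\<close>

definition pull0 :: "'a pair_pre_digraph \<Rightarrow> ('a \<Rightarrow> 'a) \<Rightarrow> ('a \<Rightarrow> real) \<Rightarrow> 'a \<Rightarrow> real" where
  "pull0 X g u = (\<lambda>v. if v \<in> pverts X then u (g v) else 0)"

definition pull1 ::
    "'a pair_pre_digraph \<Rightarrow> ('a \<Rightarrow> 'a) \<Rightarrow> ('a \<times> 'a \<Rightarrow> real) \<Rightarrow> 'a \<times> 'a \<Rightarrow> real" where
  "pull1 X g f = (\<lambda>(v, w). if (v, w) \<in> parcs X then f (g v, g w) else 0)"

text \<open>
  The inverse of the pullback is taken in the group of all bijections of the space. As the pullbacks
  are linear, images and kernels are the same as for the general linear group. On \<open>H1 X\<close> the
  pullback sends a coset to its elementwise image, which is again a coset.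
\<close>

definition phi0 :: "'a pair_pre_digraph \<Rightarrow> ('a \<Rightarrow> 'a) \<Rightarrow> ('a \<Rightarrow> real) \<Rightarrow> 'a \<Rightarrow> real" where
  "phi0 X g = inv\<^bsub>BijGroup (H0 X)\<^esub> (\<lambda>u \<in> H0 X. pull0 X g u)"

definition phi1 ::
    "'a pair_pre_digraph \<Rightarrow> ('a \<Rightarrow> 'a) \<Rightarrow> ('a \<times> 'a \<Rightarrow> real) set \<Rightarrow> ('a \<times> 'a \<Rightarrow> real) set" where
  "phi1 X g = inv\<^bsub>BijGroup (H1 X)\<^esub> (\<lambda>c \<in> H1 X. pull1 X g ` c)"

definition HH0 :: "'a pair_pre_digraph \<Rightarrow> (('a \<Rightarrow> real) \<Rightarrow> ('a \<Rightarrow> real)) monoid" where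
  "HH0 X = (BijGroup (H0 X)) \<lparr> carrier := phi0 X ` carrier (Aut X) \<rparr>"

definition HH1 ::
    "'a pair_pre_digraph \<Rightarrow> (('a \<times> 'a \<Rightarrow> real) set \<Rightarrow> ('a \<times> 'a \<Rightarrow> real) set) monoid" where
  "HH1 X = (BijGroup (H1 X)) \<lparr> carrier := phi1 X ` carrier (Aut X) \<rparr>"

definition Ker1 :: "'a pair_pre_digraph \<Rightarrow> ('a \<Rightarrow> 'a) monoid" where
  "Ker1 X = (Aut X) \<lparr> carrier := kernel (Aut X) (BijGroup (H1 X)) (phi1 X) \<rparr>"

end

theory Submission
  imports Defs
begin

text \<open>
  A form that is orthogonal to all divergence-free forms (flows) is exact, and a nonzero flow is never
  exact. Hence an automorphism acts trivially on \<open>H1\<close> iff it leaves every flow invariant.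

  Flows are supported in the core, so automorphisms fixing the core pointwise act trivially.
  Conversely, let \<open>g\<close> leave all flows invariant, let \<open>S\<close> be a connected \<open>g\<close>-invariant set of vertices,
  and let \<open>e\<close> be an edge from \<open>S\<close> to a core vertex outside \<open>S\<close>. If \<open>e\<close> and its image end in the same
  component of the complement of \<open>S\<close>, there is a flow with value \<open>1\<close> on \<open>e\<close> and \<open>-1\<close> on its image
  unless the two agree; if they end in different components, a flow passing through the first one is
  moved off its support. So \<open>g\<close> fixes \<open>e\<close>. Applied to the support of a minimal flow, this yields a fixed
  core vertex, since otherwise all flows would be multiples of that flow, contradicting \<open>b\<^sub>1 \<ge> 2\<close>;
  applied to \<open>S = {v}\<close>, it spreads the fixed vertices over the whole core.

  Finally, a component of the forest meets the core in just one vertex. Triviality of \<open>HH0\<close> of the forest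
  means that automorphisms preserve these components, so they fix the vertices shared by core and
  forest, and the restrictions of an automorphism to core and forest extend by the identity.
\<close>

section \<open>Flows and exact forms\<close>

definition divg :: "'a pair_pre_digraph \<Rightarrow> ('a \<times> 'a \<Rightarrow> real) \<Rightarrow> 'a \<Rightarrow> real" where
  "divg X k v = (\<Sum>w\<in>pverts X. k (v, w))"

text \<open>The real cycle space: within \<open>Omega1 X\<close>, for a finite graph, the orthogonal
  complement of the exact forms under \<open>form_inner\<close>.\<close>

definition flows :: "'a pair_pre_digraph \<Rightarrow> ('a \<times> 'a \<Rightarrow> real) set" where
  "flows X = {k \<in> Omega1 X. \<forall>v. divg X k v = 0}"

definition arc_form :: "'a \<Rightarrow> 'a \<Rightarrow> 'a \<times> 'a \<Rightarrow> real" where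
  "arc_form a b = (\<lambda>e. of_bool (e = (a, b)) - of_bool (e = (b, a)))"

text \<open>Each edge contributes once per orientation; hence the factor 2 against an arc form and
  the division by 2 in the potential built later.\<close>

definition form_inner ::
    "'a pair_pre_digraph \<Rightarrow> ('a \<times> 'a \<Rightarrow> real) \<Rightarrow> ('a \<times> 'a \<Rightarrow> real) \<Rightarrow> real" where
  "form_inner X f k = (\<Sum>v\<in>pverts X. \<Sum>w\<in>pverts X. f (v, w) * k (v, w))"

lemma divg_add: "divg X (f + k) v = divg X f v + divg X k v"
  by (simp add: divg_def sum.distrib)

lemma divg_diff: "divg X (f - k) v = divg X f v - divg X k v"
  by (simp add: divg_def sum_subtractf)

lemma divg_scale: "divg X (fun_scale c k) v = c * divg X k v"
  by (simp add: divg_def fun_scale_def sum_distrib_left)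

lemma form_inner_add_right: "form_inner X f (k + l) = form_inner X f k + form_inner X f l"
  by (simp add: form_inner_def sum.distrib distrib_left)

lemma form_inner_diff_right: "form_inner X f (k - l) = form_inner X f k - form_inner X f l"
  by (simp add: form_inner_def sum_subtractf right_diff_distrib)

lemma form_inner_diff_left: "form_inner X (f - k) l = form_inner X f l - form_inner X k l"
  by (simp add: form_inner_def sum_subtractf left_diff_distrib)

context pair_graph
begin

lemma Omega1_antisym:
  assumes "f \<in> Omega1 G"
  shows "f (w, v) = - f (v, w)"
proof (cases "(v, w) \<in> parcs G")
  case True
  then show ?thesis using assms by (force simp: Omega1_def)
next
  case False
  then have "(w, v) \<notin> parcs G" using arcs_symmetric by blast
  with False show ?thesis using assms by (simp add: Omega1_def)
qed

lemma Omega1_arc: "f \<in> Omega1 G \<Longrightarrow> f e \<noteq> 0 \<Longrightarrow> e \<in> parcs G"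
  unfolding Omega1_def by blast

lemma Omega1_verts:
  assumes "f \<in> Omega1 G" "f (v, w) \<noteq> 0"
  shows "v \<in> pverts G" "w \<in> pverts G"
  using Omega1_arc[OF assms] by (auto dest: in_arcsD1 in_arcsD2)

lemma Omega1I:
  assumes "\<And>v w. (v, w) \<notin> parcs G \<Longrightarrow> f (v, w) = 0" "\<And>v w. f (w, v) = - f (v, w)"
  shows "f \<in> Omega1 G"
proof -
  have "f e = 0" if "e \<notin> parcs G" for e
    using assms(1)[of "fst e" "snd e"] that by simp
  moreover have "f (v, w) = - f (w, v)" for v w
    by (rule assms(2))
  ultimately show ?thesis unfolding Omega1_def by blast
qed

lemma Omega1_add:
  assumes "f \<in> Omega1 G" "k \<in> Omega1 G"
  shows "f + k \<in> Omega1 G"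
proof (rule Omega1I)
  show "(f + k) (w, v) = - (f + k) (v, w)" for v w
    using Omega1_antisym[OF assms(1), of w v] Omega1_antisym[OF assms(2), of w v] by simp
qed (use assms in \<open>simp add: Omega1_def\<close>)

lemma Omega1_diff:
  assumes "f \<in> Omega1 G" "k \<in> Omega1 G"
  shows "f - k \<in> Omega1 G"
proof (rule Omega1I)
  show "(f - k) (w, v) = - (f - k) (v, w)" for v w
    using Omega1_antisym[OF assms(1), of w v] Omega1_antisym[OF assms(2), of w v] by simp
qed (use assms in \<open>simp add: Omega1_def\<close>)

lemma Omega1_scale:
  assumes "k \<in> Omega1 G"
  shows "fun_scale c k \<in> Omega1 G"
proof (rule Omega1I)
  show "fun_scale c k (w, v) = - fun_scale c k (v, w)" for v w
    using Omega1_antisym[OF assms, of w v] by (simp add: fun_scale_def)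
qed (use assms in \<open>simp add: Omega1_def fun_scale_def\<close>)

lemma Omega1_zero: "0 \<in> Omega1 G"
  by (simp add: Omega1_def)

lemma flows_Omega1: "k \<in> flows G \<Longrightarrow> k \<in> Omega1 G"
  by (simp add: flows_def)

lemma flows_diff: "f \<in> flows G \<Longrightarrow> k \<in> flows G \<Longrightarrow> f - k \<in> flows G"
  by (simp add: flows_def Omega1_diff divg_diff)

lemma flows_scale: "k \<in> flows G \<Longrightarrow> fun_scale c k \<in> flows G"
  by (simp add: flows_def Omega1_scale divg_scale)

lemma arc_form_Omega1:
  assumes "(a, b) \<in> parcs G"
  shows "arc_form a b \<in> Omega1 G"
proof (rule Omega1I)
  fix v w
  show "arc_form a b (v, w) = 0" if vw: "(v, w) \<notin> parcs G"
  proof -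
    have "(v, w) \<noteq> (a, b)" "(v, w) \<noteq> (b, a)"
      using vw assms arcs_symmetric[OF assms] by blast+
    then show ?thesis by (simp only: arc_form_def simp_thms of_bool_eq diff_self)
  qed
  show "arc_form a b (w, v) = - arc_form a b (v, w)"
    by (simp add: arc_form_def conj_commute)
qed

lemma divg_arc_form:
  assumes "(a, b) \<in> parcs G"
  shows "divg G (arc_form a b) v = of_bool (v = a) - of_bool (v = b)"
proof -
  have "(\<Sum>w\<in>pverts G. of_bool (v = x \<and> w = y) :: real) = of_bool (v = x)"
    if "y \<in> pverts G" for x y
    using that pair_finite_verts by (auto simp: of_bool_def)
  then show ?thesis
    using assms in_arcsD1 in_arcsD2 by (simp add: divg_def arc_form_def sum_subtractf)
qed

lemma divg_outside: "k \<in> Omega1 G \<Longrightarrow> v \<notin> pverts G \<Longrightarrow> divg G k v = 0"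
  unfolding divg_def by (rule sum.neutral) (use Omega1_verts in blast)

text \<open>Along a path from \<open>a\<close> to \<open>b\<close> the divergences of the arc forms
  telescope. Symmetry of \<open>A\<close> keeps the support inside \<open>A\<close>, since an arc
  form is nonzero on the reversed arc too. Later flows are assembled from such pieces.\<close>

lemma unit_flow_exists:
  assumes "(a, b) \<in> A\<^sup>*" "A \<subseteq> parcs G" "sym A"
  shows "\<exists>k\<in>Omega1 G. (\<forall>e. k e \<noteq> 0 \<longrightarrow> e \<in> A) \<and>
    (\<forall>v. divg G k v = of_bool (v = a) - of_bool (v = b))"
  using assms(1)
proof (induction rule: rtrancl_induct)
  case base
  show ?case by (rule bexI[OF _ Omega1_zero]) (simp add: divg_def)
next
  case (step b c)
  then obtain k where k: "k \<in> Omega1 G" "\<forall>e. k e \<noteq> 0 \<longrightarrow> e \<in> A"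
    "\<forall>v. divg G k v = of_bool (v = a) - of_bool (v = b)" by blast
  have bc: "(b, c) \<in> parcs G" "(c, b) \<in> A"
    using step(2) assms by (auto dest: symD)
  have "\<forall>e. (k + arc_form b c) e \<noteq> 0 \<longrightarrow> e \<in> A"
    using k(2) step(2) bc by (auto simp: arc_form_def)
  moreover have "\<forall>v. divg G (k + arc_form b c) v = of_bool (v = a) - of_bool (v = c)"
    by (simp add: divg_add k(3) divg_arc_form bc)
  ultimately show ?case using k(1) arc_form_Omega1[OF bc(1)] Omega1_add by blast
qed

section \<open>Orthogonality of flows and exact forms\<close>

lemma form_inner_arc_form:
  assumes "f \<in> Omega1 G" "(a, b) \<in> parcs G"
  shows "form_inner G f (arc_form a b) = 2 * f (a, b)"
proof -
  have ab: "a \<in> pverts G" "b \<in> pverts G" using assms in_arcsD1 in_arcsD2 by auto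
  have *: "(\<Sum>v\<in>pverts G. \<Sum>w\<in>pverts G. f (v, w) * of_bool (v = x \<and> w = y)) = f (x, y)"
    if "x \<in> pverts G" "y \<in> pverts G" for x y
  proof -
    have "f (v, w) * of_bool (v = x \<and> w = y) = (if w = y then if v = x then f (v, y) else 0 else 0)"
      for v w by auto
    then show ?thesis using that pair_finite_verts by simp
  qed
  show ?thesis using *[OF ab] *[OF ab(2,1)] Omega1_antisym[OF assms(1), of a b]
    by (simp add: form_inner_def arc_form_def right_diff_distrib sum_subtractf)
qed

text \<open>Summation by parts: every term becomes a value of \<open>u\<close> times a divergence of
  \<open>k\<close>.\<close>

lemma form_inner_grad_flow:
  assumes "k \<in> flows G"
  shows "form_inner G (grad G u) k = 0"
proof -
  have k: "k \<in> Omega1 G" using assms flows_Omega1 by blast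
  have "grad G u (v, w) * k (v, w) = u w * k (v, w) - u v * k (v, w)" for v w
    using Omega1_arc[OF k, of "(v, w)"] by (auto simp: grad_def left_diff_distrib)
  then have "form_inner G (grad G u) k =
    (\<Sum>v\<in>pverts G. \<Sum>w\<in>pverts G. u w * k (v, w)) - (\<Sum>v\<in>pverts G. u v * divg G k v)"
    by (simp add: form_inner_def sum_subtractf divg_def sum_distrib_left)
  also have "(\<Sum>v\<in>pverts G. \<Sum>w\<in>pverts G. u w * k (v, w)) =
    (\<Sum>w\<in>pverts G. u w * (\<Sum>v\<in>pverts G. k (v, w)))"
    by (subst sum.swap) (simp add: sum_distrib_left)
  also have "\<dots> = (\<Sum>w\<in>pverts G. u w * - divg G k w)"
    unfolding divg_def sum_negf[symmetric] by (subst Omega1_antisym[OF k]) (rule refl)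
  finally show ?thesis using assms by (simp add: flows_def)
qed

lemma form_inner_self_eq_0:
  assumes "f \<in> Omega1 G" "form_inner G f f = 0"
  shows "f = 0"
proof (rule ext)
  fix e
  have "f (v, w) = 0" if "v \<in> pverts G" "w \<in> pverts G" for v w
    using assms(2) that pair_finite_verts
    by (simp add: form_inner_def sum_nonneg_eq_0_iff sum_nonneg)
  then show "f e = 0 e" using Omega1_verts[OF assms(1)] by (metis surj_pair zero_fun_apply)
qed

text \<open>Integrating \<open>f\<close> along unit flows from a root gives a potential: two unit
  flows with the same ends differ by a flow, so by orthogonality the choice does not matter.\<close>

lemma exact_if_orthogonal_flows:
  assumes conn: "\<And>x y. x \<in> pverts G \<Longrightarrow> y \<in> pverts G \<Longrightarrow> (x, y) \<in> (parcs G)\<^sup>*"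
    and f: "f \<in> Omega1 G" and orth: "\<And>k. k \<in> flows G \<Longrightarrow> form_inner G f k = 0"
  shows "f \<in> grad G ` Omega0 G"
proof (cases "pverts G = {}")
  case True
  then have "f = grad G 0"
    using f in_arcsD1 by (auto simp: Omega1_def grad_def fun_eq_iff)
  then show ?thesis by (auto simp: Omega0_def)
next
  case False
  then obtain r where r: "r \<in> pverts G" by blast
  have symG: "sym (parcs G)" by (rule symI) (rule arcs_symmetric)
  have "\<forall>y\<in>pverts G. \<exists>k\<in>Omega1 G. \<forall>v. divg G k v = of_bool (v = r) - of_bool (v = y)"
    using unit_flow_exists[OF conn[OF r] order_refl symG] by blast
  then obtain \<kappa> where \<kappa>: "\<And>y. y \<in> pverts G \<Longrightarrow> \<kappa> y \<in> Omega1 G"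
    "\<And>y v. y \<in> pverts G \<Longrightarrow> divg G (\<kappa> y) v = of_bool (v = r) - of_bool (v = y)" by metis
  define u where "u y = (if y \<in> pverts G then form_inner G f (\<kappa> y) / 2 else 0)" for y
  have "f (y, z) = u z - u y" if yz: "(y, z) \<in> parcs G" for y z
  proof -
    have y: "y \<in> pverts G" and z: "z \<in> pverts G" using yz in_arcsD1 in_arcsD2 by auto
    \<comment> \<open>Out to \<open>y\<close>, across the arc to \<open>z\<close>, and back from
      \<open>z\<close> to the root: a closed route.\<close>
    have "\<kappa> y + arc_form y z - \<kappa> z \<in> flows G"
      using y z yz \<kappa> by (simp add: flows_def Omega1_add Omega1_diff arc_form_Omega1 divg_add
          divg_diff divg_arc_form)
    from orth[OF this] show ?thesis
      using y z by (simp add: u_def form_inner_add_right form_inner_diff_right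
          form_inner_arc_form[OF f yz])
  qed
  then have "f = grad G u" using f by (auto simp: grad_def fun_eq_iff Omega1_def)
  moreover have "u \<in> Omega0 G" by (simp add: Omega0_def u_def)
  ultimately show ?thesis by blast
qed

text \<open>Nothing leaves \<open>U\<close>, and inside \<open>U\<close> antisymmetry makes the
  double sum its own negative.\<close>

lemma sum_divg_closed:
  assumes k: "k \<in> Omega1 G" and U: "U \<subseteq> pverts G"
    and closed: "\<And>x y. x \<in> U \<Longrightarrow> k (x, y) \<noteq> 0 \<Longrightarrow> y \<in> U"
  shows "(\<Sum>x\<in>U. divg G k x) = 0"
proof -
  have "(\<Sum>x\<in>U. divg G k x) = (\<Sum>x\<in>U. \<Sum>y\<in>U. k (x, y))"
    unfolding divg_def using closed U
    by (intro sum.cong[OF refl] sum.mono_neutral_right[OF pair_finite_verts]) blast+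
  moreover have "(\<Sum>x\<in>U. \<Sum>y\<in>U. k (x, y)) = (\<Sum>x\<in>U. \<Sum>y\<in>U. - k (x, y))"
    by (subst sum.swap, rule sum.cong[OF refl], rule sum.cong[OF refl], rule Omega1_antisym[OF k])
  ultimately show ?thesis unfolding sum_negf by linarith
qed

end

section \<open>The core of a graph\<close>

lemma pverts_Cyc: "pverts (Cyc X) = pverts X - forest_verts X"
  by (simp add: Cyc_def minus_verts_def)

lemma mem_leaves_minus_verts:
  "v \<in> leaves (minus_verts X S) \<longleftrightarrow>
     v \<in> pverts X - S \<and> (\<exists>!w. (v, w) \<in> parcs X \<and> w \<notin> S)"
proof (cases "v \<in> pverts X - S")
  case True
  have "out_arcs (with_proj (minus_verts X S)) v = Pair v ` {w. (v, w) \<in> parcs X \<and> w \<notin> S}"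
    using True by (auto simp: out_arcs_def minus_verts_def)
  then have "out_degree (with_proj (minus_verts X S)) v = card {w. (v, w) \<in> parcs X \<and> w \<notin> S}"
    by (simp add: out_degree_def card_image inj_on_def)
  moreover have "card {w. P w} = 1 \<longleftrightarrow> (\<exists>!w. P w)" for P :: "'a \<Rightarrow> bool"
    by (auto simp: card_1_singleton_iff set_eq_iff)
  ultimately show ?thesis using True by (simp add: leaves_def minus_verts_def)
next
  case False
  then show ?thesis by (auto simp: leaves_def minus_verts_def)
qed

lemma mem_leaf_layer:
  "v \<in> leaf_layer X j \<longleftrightarrow>
     v \<in> pverts X \<and> (\<forall>i<j. v \<notin> leaf_layer X i) \<and>
     (\<exists>!w. (v, w) \<in> parcs X \<and> (\<forall>i<j. w \<notin> leaf_layer X i))"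
  by (subst leaf_layer.simps) (simp add: mem_leaves_minus_verts Ball_def)

lemma forest_verts_subset: "forest_verts X \<subseteq> pverts X"
proof
  fix v assume "v \<in> forest_verts X"
  then obtain j where "v \<in> leaf_layer X j" by (auto simp: forest_verts_def)
  then show "v \<in> pverts X" by (rule mem_leaf_layer[THEN iffD1, THEN conjunct1])
qed

text \<open>The first layer meeting \<open>S\<close> would contain a vertex of \<open>S\<close> with
  two distinct neighbours in \<open>S\<close>, neither of them stripped yet; such a vertex is not a
  leaf.\<close>

lemma no_forest_vertI:
  assumes "\<And>v. v \<in> S \<Longrightarrow> v \<in> forest_verts X \<Longrightarrow>
    \<exists>x\<in>S. \<exists>y\<in>S. x \<noteq> y \<and> (v, x) \<in> parcs X \<and> (v, y) \<in> parcs X"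
  shows "S \<inter> forest_verts X = {}"
proof -
  have "\<forall>v\<in>S. v \<notin> leaf_layer X j" for j
  proof (induction j rule: less_induct)
    case (less j)
    show ?case
    proof (intro ballI notI)
      fix v assume v: "v \<in> S" "v \<in> leaf_layer X j"
      then obtain x y where "x \<in> S" "y \<in> S" "x \<noteq> y" "(v, x) \<in> parcs X" "(v, y) \<in> parcs X"
        using assms unfolding forest_verts_def by blast
      moreover have "\<exists>!w. (v, w) \<in> parcs X \<and> (\<forall>i<j. w \<notin> leaf_layer X i)"
        using mem_leaf_layer[THEN iffD1, OF v(2)] by blast
      ultimately show False using less by blast
    qed
  qed
  then show ?thesis by (auto simp: forest_verts_def)
qed

text \<open>Layers are determined by adjacency and the earlier layers, so invariance passes from
  layer to layer.\<close>

lemma leaf_layer_automorphism: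
  assumes g: "g \<in> automorphisms X" and arcs: "parcs X \<subseteq> pverts X \<times> pverts X"
    and v: "v \<in> pverts X"
  shows "g v \<in> leaf_layer X j \<longleftrightarrow> v \<in> leaf_layer X j"
  using v
proof (induction j arbitrary: v rule: less_induct)
  case (less j)
  have bij: "bij_betw g (pverts X) (pverts X)"
    and adj: "\<And>v w. v \<in> pverts X \<Longrightarrow> w \<in> pverts X \<Longrightarrow> (g v, g w) \<in> parcs X \<longleftrightarrow> (v, w) \<in> parcs X"
    using g by (auto simp: automorphisms_def Bij_def)
  have gv: "g v \<in> pverts X" using bij less.prems by (auto simp: bij_betw_def)
  \<comment> \<open>\<open>w\<close> is a neighbour of \<open>v\<close> surviving the layers before
    \<open>j\<close>; that there is exactly one such \<open>w\<close> is the leaf condition for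
    \<open>v\<close>.\<close>
  define P where "P v w \<longleftrightarrow> (v, w) \<in> parcs X \<and> (\<forall>i<j. w \<notin> leaf_layer X i)" for v w
  have P: "P (g v) (g w) \<longleftrightarrow> P v w" if "w \<in> pverts X" for w
    using that less.IH less.prems adj by (auto simp: P_def)
  have "(\<exists>!w. P (g v) w) \<longleftrightarrow> (\<exists>!w. P v w)"
  proof -
    have in_verts: "w \<in> pverts X" if "P x w" for x w using that arcs by (auto simp: P_def)
    have "\<exists>!w. P v w" if "\<exists>!w. P (g v) w"
    proof -
      obtain w where w: "P (g v) w" "\<And>w'. P (g v) w' \<Longrightarrow> w' = w" using \<open>\<exists>!w. P (g v) w\<close> by blast
      obtain x where x: "x \<in> pverts X" "w = g x"
        using in_verts[OF w(1)] bij by (auto simp: bij_betw_def)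
      show ?thesis
        using w x P in_verts bij by (metis bij_betw_def inj_onD)
    qed
    moreover have "\<exists>!w. P (g v) w" if "\<exists>!w. P v w"
    proof -
      obtain x where x: "P v x" "\<And>w'. P v w' \<Longrightarrow> w' = x" using \<open>\<exists>!w. P v w\<close> by blast
      show ?thesis
      proof (rule ex1I[of _ "g x"])
        show "P (g v) (g x)" using x(1) P in_verts by blast
        fix w assume w: "P (g v) w"
        then obtain y where "y \<in> pverts X" "w = g y"
          using in_verts[OF w] bij by (auto simp: bij_betw_def)
        then show "w = g x" using x(2) P w by blast
      qed
    qed
    ultimately show ?thesis by blast
  qed
  then show ?case
    using less.IH[OF _ less.prems] gv less.prems unfolding P_def by (subst (1 2) mem_leaf_layer) auto
qed

lemma forest_verts_automorphism:
  assumes "g \<in> automorphisms X" "parcs X \<subseteq> pverts X \<times> pverts X" "v \<in> pverts X"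
  shows "g v \<in> forest_verts X \<longleftrightarrow> v \<in> forest_verts X"
  using leaf_layer_automorphism[OF assms] by (simp add: forest_verts_def)

section \<open>Cycles as flows, supports of flows, and the bound on the Betti number\<close>

lemma cycle_vec_Nil: "cycle_vec [] = 0"
  by (auto simp: cycle_vec_def)

lemma cycle_vec_Cons: "cycle_vec ((a, b) # p) = arc_form a b + cycle_vec p"
proof (rule ext)
  fix e :: "'a \<times> 'a"
  obtain v w where e: "e = (v, w)" by (cases e)
  have "real (count_list ((a, b) # p) x) = of_bool (x = (a, b)) + real (count_list p x)" for x
    by auto
  then have "real (count_list ((a, b) # p) (v, w)) = of_bool ((v, w) = (a, b)) + real (count_list p (v, w))"
    "real (count_list ((a, b) # p) (w, v)) = of_bool ((v, w) = (b, a)) + real (count_list p (w, v))"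
    by auto
  then show "cycle_vec ((a, b) # p) e = (arc_form a b + cycle_vec p) e"
    unfolding e plus_fun_apply cycle_vec_def arc_form_def case_prod_conv by linarith
qed

context pair_graph
begin

text \<open>A single nonzero summand cannot cancel.\<close>

lemma divg_0_second_arc:
  assumes k: "k \<in> Omega1 G" and "divg G k v = 0" "k (v, w) \<noteq> 0"
  shows "\<exists>w'. w' \<noteq> w \<and> k (v, w') \<noteq> 0"
proof (rule ccontr)
  assume "\<not> ?thesis"
  then have "divg G k v = (\<Sum>x\<in>{w}. k (v, x))"
    unfolding divg_def using Omega1_verts[OF k assms(3)]
    by (intro sum.mono_neutral_right[OF pair_finite_verts]) auto
  then show False using assms by simp
qed

text \<open>
  A form that is divergence free at the forest vertices has no forest vertex of degree one in its
  support, so its support lies in the core.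
\<close>

lemma support_in_Cyc:
  assumes k: "k \<in> Omega1 G" and "\<And>v. v \<in> forest_verts G \<Longrightarrow> divg G k v = 0"
    and nz: "k (v, w) \<noteq> 0"
  shows "v \<in> pverts (Cyc G) \<and> w \<in> pverts (Cyc G)"
proof -
  have sym: "k (y, x) \<noteq> 0" if "k (x, y) \<noteq> 0" for x y
    using Omega1_antisym[OF k, of x y] that by simp
  let ?S = "{v. \<exists>w. k (v, w) \<noteq> 0}"
  have "?S \<inter> forest_verts G = {}"
  proof (rule no_forest_vertI)
    fix v assume v: "v \<in> ?S" "v \<in> forest_verts G"
    then obtain w where w: "k (v, w) \<noteq> 0" by blast
    moreover obtain w' where w': "w' \<noteq> w" "k (v, w') \<noteq> 0"
      using divg_0_second_arc[OF k assms(2)[OF v(2)] w] by blast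
    ultimately show "\<exists>x\<in>?S. \<exists>y\<in>?S. x \<noteq> y \<and> (v, x) \<in> parcs G \<and> (v, y) \<in> parcs G"
      using sym Omega1_arc[OF k] by blast
  qed
  then show ?thesis
    using nz sym[OF nz] Omega1_verts[OF k nz] unfolding pverts_Cyc by blast
qed

lemma flow_support_in_Cyc:
  "k \<in> flows G \<Longrightarrow> k (v, w) \<noteq> 0 \<Longrightarrow> v \<in> pverts (Cyc G) \<and> w \<in> pverts (Cyc G)"
  by (rule support_in_Cyc) (simp_all add: flows_def)

text \<open>The divergences of the arc forms telescope along the walk; for a closed walk nothing is
  left.\<close>

lemma cycle_vec_awalk:
  assumes "awalk u p v"
  shows "cycle_vec p \<in> Omega1 G \<and> (\<forall>x. divg G (cycle_vec p) x = of_bool (x = u) - of_bool (x = v))"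
  using assms
proof (induction p arbitrary: u)
  case Nil
  then have "u = v" by (simp add: awalk_Nil_iff)
  then show ?case unfolding cycle_vec_Nil using Omega1_zero unfolding zero_fun_def by (simp add: divg_def)
next
  case (Cons e p)
  obtain a b where e: "e = (a, b)" by (cases e)
  have ab: "(a, b) \<in> parcs G" and u: "u = a" and "awalk b p v"
    using Cons.prems by (auto simp: e awalk_Cons_iff)
  then have "cycle_vec p \<in> Omega1 G"
    "\<forall>x. divg G (cycle_vec p) x = of_bool (x = b) - of_bool (x = v)"
    using Cons.IH by blast+
  then show ?case
    unfolding e u cycle_vec_Cons divg_add divg_arc_form[OF ab]
    by (intro conjI allI Omega1_add arc_form_Omega1 ab) simp_all
qed

lemma cycle_vec_flow: "cycle p \<Longrightarrow> cycle_vec p \<in> flows G"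
  using cycle_vec_awalk by (auto simp: cycle_def flows_def)

text \<open>The link between \<open>betti1\<close> and flows: cycle vectors are flows, so a line
  containing all flows contains all cycle vectors.\<close>

lemma betti1_le_1:
  assumes "flows G \<subseteq> fun_vs.span {h}"
  shows "betti1 G \<le> 1"
proof -
  have "cycle_vec ` {p. cycle p} \<subseteq> fun_vs.span {h}"
    using assms cycle_vec_flow by blast
  from fun_vs.dim_le_card[OF this] show ?thesis by (simp add: betti1_def)
qed

end

section \<open>Connected graphs with first Betti number at least two\<close>

locale betti2_graph = pair_graph +
  assumes reach: "x \<in> pverts G \<Longrightarrow> y \<in> pverts G \<Longrightarrow> (x, y) \<in> (parcs G)\<^sup>*"
    and betti: "betti1 G \<ge> 2"
begin

lemma sym_parcs: "sym (parcs G)"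
  by (rule symI) (rule arcs_symmetric)

lemma nonzero_flow_exists: "\<exists>k\<in>flows G. k \<noteq> 0"
proof (rule ccontr)
  assume "\<not> ?thesis"
  then have "k \<in> fun_vs.span {0}" if "k \<in> flows G" for k
    using that fun_vs.span_zero[of "{0}"] by metis
  then have "flows G \<subseteq> fun_vs.span {0}" by (rule subsetI)
  from betti1_le_1[OF this] betti show False by simp
qed

text \<open>A unit flow from \<open>r\<close> to \<open>v\<close> has no divergence on the forest,
  so it runs inside the core. If no core arc left \<open>U\<close>, its divergences over
  \<open>U\<close> would sum to 0, whereas \<open>U\<close> contains the source \<open>r\<close> but
  not the sink \<open>v\<close>.\<close>

lemma Cyc_connected:
  assumes U: "U \<subseteq> pverts (Cyc G)" "r \<in> U" and v: "v \<in> pverts (Cyc G)" "v \<notin> U"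
  shows "\<exists>x\<in>U. \<exists>y\<in>pverts (Cyc G) - U. (x, y) \<in> parcs G"
proof (rule ccontr)
  assume no: "\<not> ?thesis"
  have UG: "U \<subseteq> pverts G" using U by (auto simp: pverts_Cyc)
  obtain k where k: "k \<in> Omega1 G" "\<forall>x. divg G k x = of_bool (x = r) - of_bool (x = v)"
    using unit_flow_exists[OF reach order_refl sym_parcs, of r v] U v by (auto simp: pverts_Cyc)
  have "divg G k x = 0" if "x \<in> forest_verts G" for x
    using that U v by (auto simp: k(2) pverts_Cyc)
  then have "y \<in> U" if "x \<in> U" "k (x, y) \<noteq> 0" for x y
    using support_in_Cyc[OF k(1)] Omega1_arc[OF k(1)] that no by blast
  then have "(\<Sum>x\<in>U. divg G k x) = 0" by (rule sum_divg_closed[OF k(1) UG])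
  moreover have "(\<Sum>x\<in>U. divg G k x) = (\<Sum>x\<in>U. if x = r then 1 else 0)"
    using v k(2) by (intro sum.cong) auto
  ultimately show False using U finite_subset[OF UG pair_finite_verts] by simp
qed

text \<open>With \<open>s\<close> the previous vertex, a path in the core can go on without turning
  back. A core vertex with only one core neighbour would become a leaf once the forest is stripped,
  and so would belong to the forest.\<close>

lemma Cyc_two_neighbours:
  assumes v: "v \<in> pverts (Cyc G)"
  shows "\<exists>c\<in>pverts (Cyc G). c \<noteq> s \<and> (v, c) \<in> parcs G"
proof -
  obtain k e where k: "k \<in> flows G" "k e \<noteq> 0"
    using nonzero_flow_exists by (auto simp: fun_eq_iff)
  obtain a b where e: "e = (a, b)" by (cases e)
  \<comment> \<open>An arc carrying flow has two distinct core ends, so \<open>v\<close> is not the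
    only core vertex and connectedness of the core gives it a core neighbour.\<close>
  have "a \<in> pverts (Cyc G)" "b \<in> pverts (Cyc G)" "a \<noteq> b"
    using k flow_support_in_Cyc Omega1_arc[OF flows_Omega1[OF k(1)] k(2)] no_loops' by (auto simp: e)
  then obtain u where "u \<in> pverts (Cyc G)" "u \<noteq> v" by metis
  from Cyc_connected[of "{v}" v u] v this
  obtain w where w: "w \<in> pverts (Cyc G)" "(v, w) \<in> parcs G" by auto
  define L where "L j = (\<Union>i<j. leaf_layer G i)" for j
  have "finite (forest_verts G)"
    using forest_verts_subset pair_finite_verts by (rule finite_subset)
  have "\<exists>J. forest_verts G \<subseteq> L J"
  proof -
    have "\<forall>x\<in>forest_verts G. \<exists>i. x \<in> leaf_layer G i" by (auto simp: forest_verts_def)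
    then obtain f where f: "\<forall>x\<in>forest_verts G. x \<in> leaf_layer G (f x)" by metis
    \<comment> \<open>\<open>L\<close> collects the layers strictly below its argument, hence
      \<open>Suc\<close>. Layer \<open>J\<close> is then formed with the whole forest
      removed.\<close>
    have "f x < Suc (Max (f ` forest_verts G))" if "x \<in> forest_verts G" for x
      using that \<open>finite _\<close> by (simp add: less_Suc_eq_le)
    then show ?thesis using f unfolding L_def by blast
  qed
  then obtain J where J: "L J = forest_verts G" by (auto simp: L_def forest_verts_def)
  have "v \<notin> leaf_layer G J" using v by (auto simp: pverts_Cyc forest_verts_def)
  moreover have in_forest: "(\<forall>i<J. x \<notin> leaf_layer G i) \<longleftrightarrow> x \<notin> forest_verts G" for x
    unfolding J[symmetric] L_def by blast
  ultimately have "\<not> (\<exists>!w. (v, w) \<in> parcs G \<and> w \<notin> forest_verts G)"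
    using v unfolding mem_leaf_layer[of v G J] in_forest pverts_Cyc by blast
  then show ?thesis
    using w in_arcsD2 unfolding pverts_Cyc Ex1_def by (metis Diff_iff)
qed

end

section \<open>Automorphisms leaving all flows invariant\<close>

definition connected_set :: "'a pair_pre_digraph \<Rightarrow> 'a set \<Rightarrow> bool" where
  "connected_set X S \<longleftrightarrow> (\<forall>a\<in>S. \<forall>b\<in>S. (a, b) \<in> (parcs X \<inter> S \<times> S)\<^sup>*)"

text \<open>For \<open>w\<close> outside \<open>S\<close>, the component of \<open>w\<close> in the
  complement of \<open>S\<close>; for \<open>w\<close> in \<open>S\<close> it degenerates to
  \<open>{w}\<close>.\<close>

definition comp_avoiding :: "'a pair_pre_digraph \<Rightarrow> 'a set \<Rightarrow> 'a \<Rightarrow> 'a set" where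
  "comp_avoiding X S w = (parcs X \<inter> (- S) \<times> (- S))\<^sup>* `` {w}"

lemma self_in_comp_avoiding: "w \<in> comp_avoiding X S w"
  by (simp add: comp_avoiding_def)

lemma comp_avoiding_disjoint: "w \<notin> S \<Longrightarrow> comp_avoiding X S w \<inter> S = {}"
  unfolding comp_avoiding_def by (auto elim: rtranclE)

context betti2_graph
begin

lemma sym_parcs_Int: "sym (parcs G \<inter> T \<times> T)"
  using sym_parcs by (auto simp: sym_def)

lemma finite_comp_avoiding: "finite (comp_avoiding G S w)"
proof (rule finite_subset)
  show "comp_avoiding G S w \<subseteq> insert w (pverts G)"
    unfolding comp_avoiding_def by (auto elim: rtranclE dest: in_arcsD2)
qed (simp add: pair_finite_verts)

text \<open>
  Keep extending by a neighbour in the core other than the previous vertex. As the component of the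
  complement shrinks, the path eventually returns to the enlarged set and closes up.
\<close>

lemma flow_beyond_boundary:
  assumes "connected_set G S" "s \<in> S" "w \<in> pverts (Cyc G)" "w \<notin> S" "(s, w) \<in> parcs G"
  shows "\<exists>h\<in>flows G. (\<forall>x y. h (x, y) \<noteq> 0 \<longrightarrow> x \<in> comp_avoiding G S w \<union> S) \<and>
    (\<exists>x\<in>comp_avoiding G S w. \<exists>y. h (x, y) \<noteq> 0)"
  using assms
proof (induction "card (comp_avoiding G S w)" arbitrary: S s w rule: less_induct)
  case less
  note conn = less.prems(1) and s = less.prems(2) and w = less.prems(3,4) and sw = less.prems(5)
  have ws: "(w, s) \<in> parcs G" using sw by (rule arcs_symmetric)
  obtain c where c: "c \<in> pverts (Cyc G)" "c \<noteq> s" "(w, c) \<in> parcs G"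
    using Cyc_two_neighbours[OF w(1)] by blast
  have cw: "c \<noteq> w" "s \<noteq> w" using c(3) ws no_loops' by blast+
  show ?case
  proof (cases "c \<in> S")
    case True
    then have "(c, s) \<in> (parcs G \<inter> S \<times> S)\<^sup>*" using conn s by (simp add: connected_set_def)
    from unit_flow_exists[OF this _ sym_parcs_Int] obtain k where k: "k \<in> Omega1 G"
      "\<forall>e. k e \<noteq> 0 \<longrightarrow> e \<in> parcs G \<inter> S \<times> S"
      "\<forall>v. divg G k v = of_bool (v = c) - of_bool (v = s)" by blast
    \<comment> \<open>The closed route from \<open>s\<close> to \<open>w\<close> to \<open>c\<close>
      and back to \<open>s\<close> inside \<open>S\<close>.\<close>
    let ?h = "arc_form s w + arc_form w c + k"
    have "?h \<in> Omega1 G" by (intro Omega1_add arc_form_Omega1 k sw c)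
    moreover have "divg G ?h v = 0" for v
      unfolding divg_add divg_arc_form[OF sw] divg_arc_form[OF c(3)] k(3)[rule_format] by linarith
    ultimately have "?h \<in> flows G" unfolding flows_def by blast
    moreover have "x \<in> comp_avoiding G S w \<union> S" if "?h (x, y) \<noteq> 0" for x y
    proof -
      have "arc_form s w (x, y) \<noteq> 0 \<or> arc_form w c (x, y) \<noteq> 0 \<or> k (x, y) \<noteq> 0"
        using that by fastforce
      then have "x \<in> {s, w, c} \<union> S"
        using k(2) by (auto simp: arc_form_def of_bool_def split: if_splits)
      then show ?thesis using s True self_in_comp_avoiding by fast
    qed
    \<comment> \<open>Only the first arc form counts here: \<open>k\<close> lives inside
      \<open>S\<close>, and \<open>c\<close> differs from \<open>s\<close>.\<close>
    moreover have "?h (w, s) \<noteq> 0"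
    proof -
      have "k (w, s) = 0" using k(2) w(2) by blast
      then show ?thesis using c(2) cw by (simp add: arc_form_def)
    qed
    ultimately show ?thesis using self_in_comp_avoiding[of w G S] by metis
  next
    case False
    \<comment> \<open>Absorb \<open>w\<close> and continue from \<open>c\<close>. The new component
      lies in the old one and misses \<open>w\<close>, so the induction measure drops.\<close>
    let ?S = "insert w S"
    let ?R = "parcs G \<inter> ?S \<times> ?S"
    have sub: "comp_avoiding G ?S c \<subseteq> comp_avoiding G S w"
    proof
      fix x assume "x \<in> comp_avoiding G ?S c"
      then have "(c, x) \<in> (parcs G \<inter> (- S) \<times> (- S))\<^sup>*"
        unfolding comp_avoiding_def by (auto elim!: rtrancl_mono[THEN subsetD, rotated])
      moreover have "(w, c) \<in> parcs G \<inter> (- S) \<times> (- S)" using c w False by blast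
      ultimately show "x \<in> comp_avoiding G S w"
        unfolding comp_avoiding_def by (auto intro: converse_rtrancl_into_rtrancl)
    qed
    moreover have "w \<notin> comp_avoiding G ?S c"
      using comp_avoiding_disjoint[of c ?S] False cw by blast
    ultimately have "card (comp_avoiding G ?S c) < card (comp_avoiding G S w)"
      using finite_comp_avoiding self_in_comp_avoiding by (metis psubsetI psubset_card_mono)
    moreover have "connected_set G ?S"
    proof -
      have S: "(a, b) \<in> ?R\<^sup>*" if "a \<in> S" "b \<in> S" for a b
        using conn that unfolding connected_set_def
        by (meson Int_mono Sigma_mono order_refl rtrancl_mono subsetD subset_insertI)
      have "(s, w) \<in> ?R" "(w, s) \<in> ?R" using sw ws s by auto
      then have "(a, w) \<in> ?R\<^sup>*" "(w, a) \<in> ?R\<^sup>*" if "a \<in> S" for a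
        using S[OF that s] S[OF s that]
        by (auto intro: rtrancl_into_rtrancl converse_rtrancl_into_rtrancl)
      then show ?thesis using S unfolding connected_set_def by blast
    qed
    ultimately obtain h where h: "h \<in> flows G"
      "\<And>x y. h (x, y) \<noteq> 0 \<Longrightarrow> x \<in> comp_avoiding G ?S c \<union> ?S"
      "\<exists>x\<in>comp_avoiding G ?S c. \<exists>y. h (x, y) \<noteq> 0"
      using less.hyps[of ?S c w] c cw False by blast
    have "\<forall>x y. h (x, y) \<noteq> 0 \<longrightarrow> x \<in> comp_avoiding G S w \<union> S"
      using h(2) sub self_in_comp_avoiding[of w G S] by fast
    moreover have "\<exists>x\<in>comp_avoiding G S w. \<exists>y. h (x, y) \<noteq> 0"
      using h(3) by (rule bexE) (rule bexI[OF _ subsetD[OF sub]])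
    ultimately show ?thesis using h(1) by (intro bexI[of _ h] conjI)
  qed
qed

text \<open>The set \<open>S\<close> is kept general because it will be the vertex set of the
  support of a minimal flow at first, and a single fixed vertex afterwards.\<close>

lemma flow_invariant_boundary_fixed:
  assumes g: "g \<in> automorphisms G"
    and inv: "\<And>h v w. h \<in> flows G \<Longrightarrow> v \<in> pverts G \<Longrightarrow> w \<in> pverts G \<Longrightarrow> h (g v, g w) = h (v, w)"
    and S: "S \<subseteq> pverts G" "g ` S \<subseteq> S" "connected_set G S"
    and s: "s \<in> S" and w: "w \<in> pverts (Cyc G)" "w \<notin> S" and sw: "(s, w) \<in> parcs G"
  shows "g s = s \<and> g w = w"
proof (rule ccontr)
  assume moved: "\<not> ?thesis"
  have bij: "bij_betw g (pverts G) (pverts G)"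
    and adj: "\<And>v w. v \<in> pverts G \<Longrightarrow> w \<in> pverts G \<Longrightarrow> (g v, g w) \<in> parcs G \<longleftrightarrow> (v, w) \<in> parcs G"
    using g by (auto simp: automorphisms_def Bij_def)
  have V: "s \<in> pverts G" "w \<in> pverts G" using sw in_arcsD1 in_arcsD2 by auto
  have "finite S" using S(1) pair_finite_verts by (rule finite_subset)
  have inj: "inj_on g (pverts G)" using bij by (simp add: bij_betw_def)
  \<comment> \<open>By finiteness \<open>g\<close> maps \<open>S\<close> onto itself; with
    injectivity the complement is preserved too.\<close>
  have gS: "g ` S = S"
    using \<open>finite S\<close> S(2) inj_on_subset[OF inj S(1)] by (rule endo_inj_surj)
  have out: "g x \<notin> S" if "x \<in> pverts G" "x \<notin> S" for x
  proof
    assume "g x \<in> S"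
    then obtain y where "y \<in> S" "g x = g y" using gS by blast
    then show False using that inj_onD[OF inj, of x y] S(1) by blast
  qed
  let ?R = "parcs G \<inter> (- S) \<times> (- S)"
  have gsw: "(g s, g w) \<in> parcs G" using adj[OF V] sw by simp
  have gs: "g s \<in> S" using S(2) s by blast
  have gw: "g w \<notin> S" using out V w by blast
  have gne: "(s, w) \<noteq> (g s, g w)" using moved by auto
  show False
  proof (cases "g w \<in> comp_avoiding G S w")
    case True
    then have "(w, g w) \<in> ?R\<^sup>*" by (simp add: comp_avoiding_def)
    from unit_flow_exists[OF this _ sym_parcs_Int] obtain k1 where k1: "k1 \<in> Omega1 G"
      "\<forall>e. k1 e \<noteq> 0 \<longrightarrow> e \<in> ?R" "\<forall>v. divg G k1 v = of_bool (v = w) - of_bool (v = g w)" by blast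
    have "(g s, s) \<in> (parcs G \<inter> S \<times> S)\<^sup>*" using S(3) s gs by (simp add: connected_set_def)
    from unit_flow_exists[OF this _ sym_parcs_Int] obtain k2 where k2: "k2 \<in> Omega1 G"
      "\<forall>e. k2 e \<noteq> 0 \<longrightarrow> e \<in> parcs G \<inter> S \<times> S"
      "\<forall>v. divg G k2 v = of_bool (v = g s) - of_bool (v = s)" by blast
    \<comment> \<open>The closed route from \<open>s\<close> to \<open>w\<close>, outside
      \<open>S\<close> to \<open>g w\<close>, backwards over the image arc to \<open>g s\<close>,
      and inside \<open>S\<close> to \<open>s\<close>.\<close>
    let ?h = "arc_form s w + k1 - arc_form (g s) (g w) + k2"
    have "?h \<in> Omega1 G" by (intro Omega1_add Omega1_diff arc_form_Omega1 k1 k2 sw gsw)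
    moreover have "divg G ?h v = 0" for v
      unfolding divg_add divg_diff divg_arc_form[OF sw] divg_arc_form[OF gsw]
        k1(3)[rule_format] k2(3)[rule_format] by linarith
    ultimately have h: "?h \<in> flows G" unfolding flows_def by blast
    \<comment> \<open>\<open>k1\<close> lives outside \<open>S\<close> and \<open>k2\<close> inside,
      so on the two boundary arcs only the arc forms count.\<close>
    have "k1 (s, w) = 0" "k1 (g s, g w) = 0" "k2 (s, w) = 0" "k2 (g s, g w) = 0"
      using k1(2) k2(2) s gs gw w(2) by blast+
    moreover have "(s, w) \<noteq> (w, s)" "(g s, g w) \<noteq> (w, s)" "(s, w) \<noteq> (g w, g s)"
      "(g s, g w) \<noteq> (g w, g s)"
      using s gs gw w(2) by auto
    ultimately have "?h (s, w) = 1" "?h (g s, g w) = -1"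
      using gne gne[symmetric] unfolding plus_fun_apply fun_diff_def arc_form_def by simp_all
    then show False using inv[OF h V] by simp
  next
    case False
    \<comment> \<open>By invariance \<open>h\<close> is also nonzero at \<open>g x\<close>, which
      lies outside \<open>S\<close> in the component of \<open>g w\<close>. Since \<open>h\<close>
      lives on \<open>S\<close> and the component of \<open>w\<close>, the two components would have
      to coincide.\<close>
    obtain h x y where h: "h \<in> flows G"
      "\<And>x y. h (x, y) \<noteq> 0 \<Longrightarrow> x \<in> comp_avoiding G S w \<union> S"
      and x: "x \<in> comp_avoiding G S w" "h (x, y) \<noteq> 0"
      using flow_beyond_boundary[OF S(3) s w sw] by blast
    have xy: "x \<in> pverts G" "y \<in> pverts G" using Omega1_verts[OF flows_Omega1[OF h(1)] x(2)] by auto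
    have "(g w, g z) \<in> ?R\<^sup>*" if "(w, z) \<in> ?R\<^sup>*" for z
      using that
    proof (induction rule: rtrancl_induct)
      case (step y z)
      then have "y \<in> pverts G" "z \<in> pverts G" "y \<notin> S" "z \<notin> S" "(y, z) \<in> parcs G"
        using in_arcsD1 in_arcsD2 by auto
      then have "(g y, g z) \<in> ?R" using adj out by blast
      with step.IH show ?case by (rule rtrancl_into_rtrancl)
    qed simp
    then have gwx: "(g w, g x) \<in> ?R\<^sup>*" using x(1) by (simp add: comp_avoiding_def)
    have "g x \<notin> S"
      using out xy(1) x(1) comp_avoiding_disjoint[OF w(2)] by blast
    moreover have "h (g x, g y) \<noteq> 0" using inv[OF h(1) xy] x(2) by simp
    ultimately have "(w, g x) \<in> ?R\<^sup>*" using h(2) by (auto simp: comp_avoiding_def)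
    moreover have "(g x, g w) \<in> ?R\<^sup>*"
      using gwx sym_rtrancl[OF sym_parcs_Int] by (rule symD[rotated])
    ultimately have "(w, g w) \<in> ?R\<^sup>*" by (rule rtrancl_trans)
    then show False using False by (simp add: comp_avoiding_def)
  qed
qed

section \<open>Fixed vertices in the core\<close>

lemma minimal_support_flow:
  obtains h where "h \<in> flows G" "h \<noteq> 0"
    "\<And>k. k \<in> flows G \<Longrightarrow> {e. k e \<noteq> 0} \<subset> {e. h e \<noteq> 0} \<Longrightarrow> k = 0"
proof -
  define P where "P h \<longleftrightarrow> h \<in> flows G \<and> h \<noteq> 0" for h
  have "\<exists>h. P h" using nonzero_flow_exists by (auto simp: P_def)
  \<comment> \<open>Least cardinality implies minimality under inclusion because the support is
    finite.\<close>
  then obtain h where h: "P h" "\<And>k. P k \<Longrightarrow> card {e. h e \<noteq> 0} \<le> card {e. k e \<noteq> 0}"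
    using ex_has_least_nat[of P _ "\<lambda>h. card {e. h e \<noteq> 0}"] by blast
  have "finite {e. h e \<noteq> 0}"
    using h(1) Omega1_arc flows_Omega1 by (intro finite_subset[OF _ pair_finite_arcs]) (auto simp: P_def)
  then have "k = 0" if "k \<in> flows G" "{e. k e \<noteq> 0} \<subset> {e. h e \<noteq> 0}" for k
    using that h(2)[of k] psubset_card_mono[of "{e. h e \<noteq> 0}" "{e. k e \<noteq> 0}"]
    by (auto simp: P_def simp del: zero_fun_apply)
  then show thesis using that h(1) by (auto simp: P_def)
qed

lemma flow_invariant_fixed_core_vertex:
  assumes g: "g \<in> automorphisms G"
    and inv: "\<And>h v w. h \<in> flows G \<Longrightarrow> v \<in> pverts G \<Longrightarrow> w \<in> pverts G \<Longrightarrow> h (g v, g w) = h (v, w)"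
  shows "\<exists>v\<in>pverts (Cyc G). g v = v"
proof (rule ccontr)
  assume none: "\<not> ?thesis"
  have bij: "bij_betw g (pverts G) (pverts G)"
    and adj: "\<And>v w. v \<in> pverts G \<Longrightarrow> w \<in> pverts G \<Longrightarrow> (g v, g w) \<in> parcs G \<longleftrightarrow> (v, w) \<in> parcs G"
    using g by (auto simp: automorphisms_def Bij_def)
  obtain h where h: "h \<in> flows G" "h \<noteq> 0"
    and min: "\<And>k. k \<in> flows G \<Longrightarrow> {e. k e \<noteq> 0} \<subset> {e. h e \<noteq> 0} \<Longrightarrow> k = 0"
    using minimal_support_flow by blast
  note h1 = flows_Omega1[OF h(1)]
  define T where "T = {e. h e \<noteq> 0}"
  define S where "S = fst ` T"
  have TG: "T \<subseteq> parcs G" using Omega1_arc[OF h1] by (auto simp: T_def)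
  have symT: "sym T"
  proof (rule symI)
    show "(y, x) \<in> T" if "(x, y) \<in> T" for x y
      using that Omega1_antisym[OF h1, of y x] by (simp add: T_def)
  qed
  have TS: "x \<in> S \<and> y \<in> S" if "(x, y) \<in> T" for x y
    using that symD[OF symT that] by (force simp: S_def)
  have SV: "S \<subseteq> pverts G" using TG in_arcsD1 by (auto simp: S_def)
  have SC: "S \<subseteq> pverts (Cyc G)" using flow_support_in_Cyc[OF h(1)] by (auto simp: S_def T_def)
  \<comment> \<open>Otherwise cutting \<open>h\<close> down to the part of its support reachable
    from \<open>a\<close> gives a nonzero flow of strictly smaller support.\<close>
  have T_conn: "(a, b) \<in> T\<^sup>*" if a: "a \<in> S" and b: "b \<in> S" for a b
  proof (rule ccontr)
    assume nab: "(a, b) \<notin> T\<^sup>*"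
    define U where "U = T\<^sup>* `` {a}"
    have U: "x \<in> U \<longleftrightarrow> y \<in> U" if "(x, y) \<in> T" for x y
      using that symD[OF symT that] unfolding U_def by (auto intro: rtrancl_into_rtrancl)
    define k where "k = (\<lambda>(x, y). if x \<in> U then h (x, y) else 0)"
    have kh: "k (w, v) = - k (v, w)" for v w
    proof (cases "h (v, w) = 0")
      case True
      then show ?thesis using Omega1_antisym[OF h1, of w v] by (simp add: k_def)
    next
      case False
      then have "v \<in> U \<longleftrightarrow> w \<in> U" using U by (simp add: T_def)
      then show ?thesis using Omega1_antisym[OF h1, of w v] by (simp add: k_def)
    qed
    have "k \<in> Omega1 G"
    proof (rule Omega1I)
      show "k (v, w) = 0" if "(v, w) \<notin> parcs G" for v w
        using that Omega1_arc[OF h1, of "(v, w)"] by (auto simp: k_def)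
    qed (rule kh)
    moreover have "divg G k v = (if v \<in> U then divg G h v else 0)" for v
      by (simp add: divg_def k_def)
    ultimately have kf: "k \<in> flows G" using h(1) by (simp add: flows_def)
    obtain b' where b': "(b, b') \<in> T" using b by (auto simp: S_def)
    obtain a' where a': "(a, a') \<in> T" using a by (auto simp: S_def)
    have "k (b, b') = 0" using nab by (simp add: k_def U_def)
    moreover have "h (b, b') \<noteq> 0" using b' by (simp add: T_def)
    moreover have "h e \<noteq> 0" if "k e \<noteq> 0" for e
      using that by (cases e) (simp add: k_def split: if_splits)
    ultimately have "{e. k e \<noteq> 0} \<subset> {e. h e \<noteq> 0}" by blast
    from min[OF kf this] have "k (a, a') = 0" by simp
    moreover have "k (a, a') \<noteq> 0" using a' by (simp add: k_def U_def T_def)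
    ultimately show False by simp
  qed
  have Tinv: "(g x, g y) \<in> T \<longleftrightarrow> (x, y) \<in> T" if "x \<in> pverts G" "y \<in> pverts G" for x y
    using inv[OF h(1) that] by (simp add: T_def)
  have "g ` S \<subseteq> S"
  proof
    fix z assume "z \<in> g ` S"
    then obtain x y where "(x, y) \<in> T" "z = g x" by (auto simp: S_def)
    then show "z \<in> S" using Tinv TG TS in_arcsD1 in_arcsD2 by blast
  qed
  moreover have "connected_set G S"
  proof -
    have "T \<subseteq> parcs G \<inter> S \<times> S" using TG TS by auto
    then show ?thesis
      unfolding connected_set_def using T_conn rtrancl_mono by blast
  qed
  \<comment> \<open>The boundary lemma would fix the core vertex \<open>y\<close>. Without exits,
    connectedness of the core makes \<open>S\<close> all of it.\<close>
  ultimately have no_exit: "(x, y) \<notin> parcs G" if "x \<in> S" "y \<in> pverts (Cyc G) - S" for x y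
    using flow_invariant_boundary_fixed[OF g inv SV, of x y] that none by blast
  obtain r where r: "r \<in> S" using h(2) by (force simp: S_def T_def fun_eq_iff)
  have CS: "v \<in> S" if "v \<in> pverts (Cyc G)" for v
    using Cyc_connected[OF SC r that] no_exit by blast
  \<comment> \<open>An arc outside \<open>T\<close> closes up through \<open>T\<close> to a flow
    with value 1 on it. The image arc also lies outside \<open>T\<close>, so there only the arc form
    can supply the value 1 that invariance demands.\<close>
  have supp: "(a, b) \<in> T" if q: "q \<in> flows G" "q (a, b) \<noteq> 0" for q a b
  proof (rule ccontr)
    assume nT: "(a, b) \<notin> T"
    have ab: "a \<in> pverts (Cyc G)" "b \<in> pverts (Cyc G)" using flow_support_in_Cyc[OF q] by auto
    have abG: "(a, b) \<in> parcs G" using Omega1_arc[OF flows_Omega1[OF q(1)] q(2)] .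
    have V: "a \<in> pverts G" "b \<in> pverts G" using ab SV CS by auto
    obtain k where k: "k \<in> Omega1 G" "\<forall>e. k e \<noteq> 0 \<longrightarrow> e \<in> T"
      "\<forall>v. divg G k v = of_bool (v = b) - of_bool (v = a)"
      using unit_flow_exists[OF T_conn TG symT, of b a] CS ab by blast
    let ?h = "arc_form a b + k"
    have "?h \<in> Omega1 G" by (intro Omega1_add arc_form_Omega1 k abG)
    moreover have "divg G ?h v = 0" for v
      unfolding divg_add divg_arc_form[OF abG] k(3)[rule_format] by linarith
    ultimately have hf: "?h \<in> flows G" unfolding flows_def by blast
    have k0: "k (a, b) = 0" "k (g a, g b) = 0" using k(2) nT Tinv[OF V] by blast+
    have "a \<noteq> b" using abG no_loops' by blast
    then have "?h (a, b) = 1" using k0 by (simp add: arc_form_def)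
    then have "?h (g a, g b) = 1" using inv[OF hf V] by simp
    then have "arc_form a b (g a, g b) = 1" using k0 by simp
    \<comment> \<open>Value 1 would force \<open>g a = a\<close>; only 0 and, for a reversed arc, -1
      remain.\<close>
    moreover have "arc_form a b (g a, g b) \<le> 0"
      using none ab(1) by (auto simp: arc_form_def)
    ultimately show False by linarith
  qed
  have "q \<in> fun_vs.span {h}" if q: "q \<in> flows G" for q
  proof -
    obtain e where e: "h e \<noteq> 0" using h(2) by (auto simp: fun_eq_iff)
    \<comment> \<open>Subtracting the multiple of \<open>h\<close> that cancels \<open>q\<close> at
      \<open>e\<close> shrinks the support strictly, so minimality leaves nothing.\<close>
    let ?k = "q - fun_scale (q e / h e) h"
    have kf: "?k \<in> flows G" by (intro flows_diff flows_scale q h)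
    have "?k e = 0" using e by (simp add: fun_scale_def)
    moreover have "h x \<noteq> 0" if "?k x \<noteq> 0" for x
    proof (cases "q x = 0")
      case True
      then show ?thesis using that by (simp add: fun_scale_def)
    next
      case False
      then show ?thesis using supp[OF q] by (cases x) (simp add: T_def)
    qed
    ultimately have "{x. ?k x \<noteq> 0} \<subset> {x. h x \<noteq> 0}" using e by blast
    from min[OF kf this] have "q = fun_scale (q e / h e) h" by (simp only: right_minus_eq)
    then show ?thesis by (metis fun_vs.span_base fun_vs.span_scale singletonI)
  qed
  then have "betti1 G \<le> 1" by (intro betti1_le_1[of h] subsetI)
  then show False using betti by simp
qed

text \<open>If some core vertex moved, a core arc would join a fixed vertex to a moved one. The
  boundary lemma, applied to the singleton of the fixed end, excludes this.\<close>

lemma flow_invariant_fixes_Cyc: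
  assumes g: "g \<in> automorphisms G"
    and inv: "\<And>h v w. h \<in> flows G \<Longrightarrow> v \<in> pverts G \<Longrightarrow> w \<in> pverts G \<Longrightarrow> h (g v, g w) = h (v, w)"
    and v: "v \<in> pverts (Cyc G)"
  shows "g v = v"
proof (rule ccontr)
  assume nv: "g v \<noteq> v"
  let ?U = "{v \<in> pverts (Cyc G). g v = v}"
  obtain r where r: "r \<in> ?U" using flow_invariant_fixed_core_vertex[OF g inv] by blast
  have "\<exists>x\<in>?U. \<exists>y\<in>pverts (Cyc G) - ?U. (x, y) \<in> parcs G"
    using r nv v by (intro Cyc_connected[of ?U r v]) auto
  then obtain x y where x: "x \<in> pverts (Cyc G)" "g x = x"
    and y: "y \<in> pverts (Cyc G)" "g y \<noteq> y" and xy: "(x, y) \<in> parcs G" by blast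
  have "connected_set G {x}" by (simp add: connected_set_def)
  moreover have "{x} \<subseteq> pverts G" using x by (simp add: pverts_Cyc)
  moreover have "y \<notin> {x}" using x y by auto
  ultimately show False
    using flow_invariant_boundary_fixed[OF g inv, of "{x}" x y] x y xy by simp
qed

end

section \<open>Actions on cohomology\<close>

text \<open>Pullback reverses products; inversion in \<open>BijGroup S\<close> restores their order
  and leaves the kernel unchanged. The abstract form serves both \<open>H0\<close> and
  \<open>H1\<close>.\<close>

lemma inv_right_action:
  assumes "group A"
    and closed: "\<And>g x. g \<in> carrier A \<Longrightarrow> x \<in> S \<Longrightarrow> act g x \<in> S"
    and one: "\<And>x. x \<in> S \<Longrightarrow> act \<one>\<^bsub>A\<^esub> x = x"
    and mult: "\<And>g h x. g \<in> carrier A \<Longrightarrow> h \<in> carrier A \<Longrightarrow> x \<in> S \<Longrightarrow>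
      act (g \<otimes>\<^bsub>A\<^esub> h) x = act h (act g x)"
  defines "\<phi> \<equiv> \<lambda>g. inv\<^bsub>BijGroup S\<^esub> (\<lambda>x\<in>S. act g x)"
  shows "\<phi> \<in> hom A (BijGroup S)"
    and "g \<in> carrier A \<Longrightarrow> \<phi> g = \<one>\<^bsub>BijGroup S\<^esub> \<longleftrightarrow> (\<forall>x\<in>S. act g x = x)"
proof -
  interpret A: group A by fact
  interpret B: group "BijGroup S" by (rule group_BijGroup)
  have Bij: "(\<lambda>x\<in>S. act g x) \<in> carrier (BijGroup S)" if g: "g \<in> carrier A" for g
  proof -
    have "act (inv\<^bsub>A\<^esub> g) (act g x) = x" "act g (act (inv\<^bsub>A\<^esub> g) x) = x" if "x \<in> S" for x
      using mult[of g "inv\<^bsub>A\<^esub> g" x] mult[of "inv\<^bsub>A\<^esub> g" g x] g that one by simp_all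
    then have "bij_betw (act g) S S"
      using closed[OF g] closed[OF A.inv_closed[OF g]]
      by (intro bij_betw_byWitness[of _ "act (inv\<^bsub>A\<^esub> g)"]) auto
    then show ?thesis by (simp add: BijGroup_def Bij_def)
  qed
  show "\<phi> \<in> hom A (BijGroup S)"
  proof (rule homI)
    show "\<phi> g \<in> carrier (BijGroup S)" if "g \<in> carrier A" for g
      using Bij[OF that] by (simp add: \<phi>_def)
    show "\<phi> (g \<otimes>\<^bsub>A\<^esub> h) = \<phi> g \<otimes>\<^bsub>BijGroup S\<^esub> \<phi> h"
      if g: "g \<in> carrier A" and h: "h \<in> carrier A" for g h
    proof -
      have "(\<lambda>x\<in>S. act (g \<otimes>\<^bsub>A\<^esub> h) x) = (\<lambda>x\<in>S. act h x) \<otimes>\<^bsub>BijGroup S\<^esub> (\<lambda>x\<in>S. act g x)"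
        using Bij[OF g] Bij[OF h] closed[OF g] mult[OF g h]
        by (auto simp: BijGroup_def compose_def restrict_def)
      then show ?thesis using Bij[OF g] Bij[OF h] by (simp add: \<phi>_def B.inv_mult_group)
    qed
  qed
  show "\<phi> g = \<one>\<^bsub>BijGroup S\<^esub> \<longleftrightarrow> (\<forall>x\<in>S. act g x = x)" if g: "g \<in> carrier A"
  proof -
    have "\<phi> g = \<one>\<^bsub>BijGroup S\<^esub> \<longleftrightarrow> (\<lambda>x\<in>S. act g x) = \<one>\<^bsub>BijGroup S\<^esub>"
      using B.inv_eq_1_iff[OF Bij[OF g]] by (simp add: \<phi>_def)
    also have "\<dots> \<longleftrightarrow> (\<forall>x\<in>S. act g x = x)"
      by (simp add: BijGroup_def restrict_def fun_eq_iff) metis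
    finally show ?thesis .
  qed
qed

section \<open>The automorphism group\<close>

lemma automorphisms_bij: "g \<in> automorphisms X \<Longrightarrow> bij_betw g (pverts X) (pverts X)"
  by (simp add: automorphisms_def Bij_def)

lemma automorphisms_closed: "g \<in> automorphisms X \<Longrightarrow> v \<in> pverts X \<Longrightarrow> g v \<in> pverts X"
  using automorphisms_bij by (metis bij_betwE)

lemma automorphisms_adj:
  "g \<in> automorphisms X \<Longrightarrow> v \<in> pverts X \<Longrightarrow> w \<in> pverts X \<Longrightarrow>
    (g v, g w) \<in> parcs X \<longleftrightarrow> (v, w) \<in> parcs X"
  by (simp add: automorphisms_def)

lemma automorphisms_outside: "g \<in> automorphisms X \<Longrightarrow> v \<notin> pverts X \<Longrightarrow> g v = undefined"
  by (auto simp: automorphisms_def Bij_def extensional_def)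

lemma automorphisms_eqI:
  assumes "g \<in> automorphisms X" "h \<in> automorphisms X" "\<And>v. v \<in> pverts X \<Longrightarrow> g v = h v"
  shows "g = h"
proof
  show "g v = h v" for v
    using assms automorphisms_outside[of g X v] automorphisms_outside[of h X v]
    by (cases "v \<in> pverts X") simp_all
qed

lemma automorphismsI:
  assumes "g \<in> extensional (pverts X)" "bij_betw g (pverts X) (pverts X)"
    and "\<And>v w. v \<in> pverts X \<Longrightarrow> w \<in> pverts X \<Longrightarrow> (g v, g w) \<in> parcs X \<longleftrightarrow> (v, w) \<in> parcs X"
  shows "g \<in> automorphisms X"
  using assms by (simp add: automorphisms_def Bij_def)

lemma carrier_Aut: "carrier (Aut X) = automorphisms X"
  by (simp add: Aut_def)

lemma one_Aut: "\<one>\<^bsub>Aut X\<^esub> = (\<lambda>v\<in>pverts X. v)"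
  by (simp add: Aut_def BijGroup_def)

lemma mult_Aut:
  "g \<in> automorphisms X \<Longrightarrow> h \<in> automorphisms X \<Longrightarrow> g \<otimes>\<^bsub>Aut X\<^esub> h = compose (pverts X) g h"
  by (simp add: Aut_def BijGroup_def automorphisms_def)

lemma group_Aut: "group (Aut X)"
proof -
  interpret B: group "BijGroup (pverts X)" by (rule group_BijGroup)
  have "subgroup (automorphisms X) (BijGroup (pverts X))"
  proof (rule B.subgroupI)
    show "automorphisms X \<subseteq> carrier (BijGroup (pverts X))"
      by (auto simp: automorphisms_def BijGroup_def)
    have "(\<lambda>v\<in>pverts X. v) \<in> automorphisms X" by (simp add: automorphisms_def id_Bij)
    then show "automorphisms X \<noteq> {}" by blast
  next
    fix g assume g: "g \<in> automorphisms X"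
    then have gB: "g \<in> Bij (pverts X)" by (simp add: automorphisms_def)
    have im: "g ` pverts X = pverts X" using automorphisms_bij[OF g] by (simp add: bij_betw_def)
    let ?h = "\<lambda>v\<in>pverts X. inv_into (pverts X) g v"
    have "(?h v, ?h w) \<in> parcs X \<longleftrightarrow> (v, w) \<in> parcs X" if "v \<in> pverts X" "w \<in> pverts X" for v w
      using automorphisms_adj[OF g, of "?h v" "?h w"] that im
      by (simp add: inv_into_into f_inv_into_f)
    then show "inv\<^bsub>BijGroup (pverts X)\<^esub> g \<in> automorphisms X"
      unfolding inv_BijGroup[OF gB] using restrict_inv_into_Bij[OF gB]
      unfolding automorphisms_def by blast
  next
    fix g h assume g: "g \<in> automorphisms X" and h: "h \<in> automorphisms X"
    then have B: "g \<in> Bij (pverts X)" "h \<in> Bij (pverts X)" by (auto simp: automorphisms_def)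
    then have "g \<otimes>\<^bsub>BijGroup (pverts X)\<^esub> h = compose (pverts X) g h" by (simp add: BijGroup_def)
    then show "g \<otimes>\<^bsub>BijGroup (pverts X)\<^esub> h \<in> automorphisms X"
      using compose_Bij[OF B] automorphisms_adj[OF g] automorphisms_adj[OF h]
        automorphisms_closed[OF h]
      by (simp add: automorphisms_def compose_def)
  qed
  then show ?thesis unfolding Aut_def by (rule B.subgroup_imp_group)
qed

lemma id_automorphism: "(\<lambda>v\<in>pverts X. v) \<in> automorphisms X"
  using group.is_monoid[OF group_Aut, of X] monoid.one_closed[of "Aut X"]
  by (simp add: carrier_Aut one_Aut)

lemma mult_Aut_closed:
  assumes "g \<in> automorphisms X" "h \<in> automorphisms X"
  shows "g \<otimes>\<^bsub>Aut X\<^esub> h \<in> automorphisms X"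
  using monoid.m_closed[OF group.is_monoid[OF group_Aut]] assms by (metis carrier_Aut)

lemma mult_Aut_apply:
  "g \<in> automorphisms X \<Longrightarrow> h \<in> automorphisms X \<Longrightarrow> v \<in> pverts X \<Longrightarrow> (g \<otimes>\<^bsub>Aut X\<^esub> h) v = g (h v)"
  by (simp add: mult_Aut compose_def)

section \<open>The action on \<open>H0\<close>\<close>

lemma H0_arcs:
  assumes "parcs X \<subseteq> pverts X \<times> pverts X"
  shows "u \<in> H0 X \<longleftrightarrow> u \<in> Omega0 X \<and> (\<forall>(v, w)\<in>parcs X. u v = u w)"
proof -
  have "v \<rightarrow>\<^sup>*\<^bsub>with_proj X\<^esub> w" if "(v, w) \<in> parcs X" for v w
  proof -
    have "(v, v) \<in> rtrancl_on (pverts X) (parcs X)" "w \<in> pverts X"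
      using that assms by (auto intro: rtrancl_on_refl)
    then show ?thesis
      using that unfolding reachable_def with_proj_simps by (auto intro: rtrancl_on_into_rtrancl_on)
  qed
  moreover have "u v = u w" if "\<forall>(v, w)\<in>parcs X. u v = u w" "v \<rightarrow>\<^sup>*\<^bsub>with_proj X\<^esub> w" for v w
    using that(2) unfolding reachable_def with_proj_simps
    by (induction rule: rtrancl_on_induct) (use that(1) in auto)
  ultimately have "(\<forall>v w. v \<rightarrow>\<^sup>*\<^bsub>with_proj X\<^esub> w \<longrightarrow> u v = u w) \<longleftrightarrow> (\<forall>(v, w)\<in>parcs X. u v = u w)"
    by fast
  then show ?thesis by (simp add: H0_def)
qed

lemma phi0_eq_one_iff:
  assumes arcs: "parcs X \<subseteq> pverts X \<times> pverts X" and g: "g \<in> automorphisms X"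
  shows "phi0 X g = \<one>\<^bsub>BijGroup (H0 X)\<^esub> \<longleftrightarrow> (\<forall>u\<in>H0 X. pull0 X g u = u)"
  unfolding phi0_def
proof (rule inv_right_action(2)[where act = "pull0 X" and A = "Aut X", OF group_Aut])
  show "pull0 X g u \<in> H0 X" if g: "g \<in> carrier (Aut X)" and u: "u \<in> H0 X" for g u
  proof -
    have g: "g \<in> automorphisms X" using g by (simp add: carrier_Aut)
    have "pull0 X g u v = pull0 X g u w" if vw: "(v, w) \<in> parcs X" for v w
    proof -
      have V: "v \<in> pverts X" "w \<in> pverts X" using vw arcs by auto
      then have "(g v, g w) \<in> parcs X" using automorphisms_adj[OF g V] vw by simp
      then show ?thesis using u V by (auto simp: H0_arcs[OF arcs] pull0_def)
    qed
    then show ?thesis by (auto simp: H0_arcs[OF arcs] Omega0_def pull0_def)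
  qed
  show "pull0 X \<one>\<^bsub>Aut X\<^esub> u = u" if "u \<in> H0 X" for u
    using that by (auto simp: H0_def Omega0_def pull0_def one_Aut)
  show "pull0 X (g \<otimes>\<^bsub>Aut X\<^esub> h) u = pull0 X h (pull0 X g u)"
    if "g \<in> carrier (Aut X)" "h \<in> carrier (Aut X)" "u \<in> H0 X" for g h u
    using that by (auto simp: pull0_def carrier_Aut mult_Aut_apply automorphisms_closed)
qed (simp add: carrier_Aut g)

section \<open>Pullback of forms and the action on \<open>H1\<close>\<close>

context pair_graph
begin

lemma parcs_subset: "parcs G \<subseteq> pverts G \<times> pverts G"
  by (auto dest: in_arcsD1 in_arcsD2)

text \<open>This includes nonadjacent pairs: \<open>g\<close> preserves nonadjacency, so both sides
  vanish there.\<close>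

lemma pull1_apply:
  assumes "g \<in> automorphisms G" "f \<in> Omega1 G" "v \<in> pverts G" "w \<in> pverts G"
  shows "pull1 G g f (v, w) = f (g v, g w)"
  using automorphisms_adj[OF assms(1,3,4)] Omega1_arc[OF assms(2), of "(g v, g w)"]
  by (auto simp: pull1_def)

lemma pull1_Omega1:
  assumes g: "g \<in> automorphisms G" and f: "f \<in> Omega1 G"
  shows "pull1 G g f \<in> Omega1 G"
proof (rule Omega1I)
  show "pull1 G g f (w, v) = - pull1 G g f (v, w)" for v w
  proof (cases "(v, w) \<in> parcs G")
    case True
    then show ?thesis
      using arcs_symmetric[OF True] Omega1_antisym[OF f, of "g w" "g v"] by (simp add: pull1_def)
  next
    case False
    then have "(w, v) \<notin> parcs G" using arcs_symmetric by blast
    then show ?thesis using False by (simp add: pull1_def)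
  qed
qed (simp add: pull1_def)

lemma pull1_one: "f \<in> Omega1 G \<Longrightarrow> pull1 G \<one>\<^bsub>Aut G\<^esub> f = f"
  using parcs_subset by (auto simp: pull1_def one_Aut Omega1_def fun_eq_iff)

lemma pull1_mult:
  assumes "g \<in> automorphisms G" "h \<in> automorphisms G"
  shows "pull1 G (g \<otimes>\<^bsub>Aut G\<^esub> h) f = pull1 G h (pull1 G g f)"
proof
  fix e :: "'a \<times> 'a"
  obtain v w where e: "e = (v, w)" by (cases e)
  show "pull1 G (g \<otimes>\<^bsub>Aut G\<^esub> h) f e = pull1 G h (pull1 G g f) e"
  proof (cases "(v, w) \<in> parcs G")
    case True
    then have "v \<in> pverts G" "w \<in> pverts G" using parcs_subset by auto
    then show ?thesis using True assms automorphisms_adj[OF assms(2), of v w]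
      by (simp add: e pull1_def mult_Aut_apply)
  qed (simp add: e pull1_def)
qed

lemma pull1_diff: "pull1 G g (f - k) = pull1 G g f - pull1 G g k"
  by (auto simp: pull1_def fun_eq_iff)

text \<open>Pullback commutes with the gradient.\<close>

lemma pull1_exact:
  assumes g: "g \<in> automorphisms G" and f: "f \<in> grad G ` Omega0 G"
  shows "pull1 G g f \<in> grad G ` Omega0 G"
proof -
  obtain u where u: "f = grad G u" using f by blast
  have "pull1 G g (grad G u) = grad G (pull0 G g u)"
  proof
    fix e :: "'a \<times> 'a"
    obtain v w where e: "e = (v, w)" by (cases e)
    show "pull1 G g (grad G u) e = grad G (pull0 G g u) e"
    proof (cases "(v, w) \<in> parcs G")
      case True
      then have "v \<in> pverts G" "w \<in> pverts G" using parcs_subset by auto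
      then show ?thesis using True automorphisms_adj[OF g, of v w]
        by (simp add: e pull1_def grad_def pull0_def)
    qed (simp add: e pull1_def grad_def)
  qed
  moreover have "pull0 G g u \<in> Omega0 G" by (simp add: Omega0_def pull0_def)
  ultimately show ?thesis unfolding u by blast
qed

definition cohomologous :: "(('a \<times> 'a \<Rightarrow> real) \<times> ('a \<times> 'a \<Rightarrow> real)) set" where
  "cohomologous = {(f, f'). f \<in> Omega1 G \<and> f' \<in> Omega1 G \<and> f - f' \<in> grad G ` Omega0 G}"

lemma grad_diff: "grad G (u - v) = grad G u - grad G v"
  by (auto simp: grad_def fun_eq_iff)

lemma exact_diff:
  assumes "f \<in> grad G ` Omega0 G" "k \<in> grad G ` Omega0 G"
  shows "f - k \<in> grad G ` Omega0 G"
proof -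
  obtain u v where "f = grad G u" "k = grad G v" "u \<in> Omega0 G" "v \<in> Omega0 G"
    using assms by blast
  moreover have "u - v \<in> Omega0 G" using \<open>u \<in> _\<close> \<open>v \<in> _\<close> by (simp add: Omega0_def)
  ultimately show ?thesis by (metis grad_diff image_eqI)
qed

lemma exact_zero: "0 \<in> grad G ` Omega0 G"
  by (rule image_eqI[of _ _ 0]) (auto simp: grad_def Omega0_def)

lemma equiv_cohomologous: "equiv (Omega1 G) cohomologous"
proof (rule equivI)
  show "cohomologous \<subseteq> Omega1 G \<times> Omega1 G" by (auto simp: cohomologous_def)
  have "(f, f) \<in> cohomologous" if "f \<in> Omega1 G" for f
    unfolding cohomologous_def diff_self mem_Collect_eq case_prod_conv using that exact_zero by blast
  then show "refl_on (Omega1 G) cohomologous" by (intro refl_onI)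
  show "sym cohomologous"
  proof (rule symI)
    fix f k assume "(f, k) \<in> cohomologous"
    then show "(k, f) \<in> cohomologous"
      using exact_diff[OF exact_zero, of "f - k"]
      unfolding cohomologous_def mem_Collect_eq case_prod_conv diff_0 minus_diff_eq by blast
  qed
  show "trans cohomologous"
  proof (rule transI)
    fix f k l assume fk: "(f, k) \<in> cohomologous" and kl: "(k, l) \<in> cohomologous"
    \<comment> \<open>The sum of the two differences, written with subtractions so that closure
      under differences applies.\<close>
    have "f - k - (0 - (k - l)) \<in> grad G ` Omega0 G"
      by (rule exact_diff[OF _ exact_diff[OF exact_zero]])
        (use fk kl in \<open>auto simp: cohomologous_def simp del: minus_apply\<close>)
    moreover have "f - k - (0 - (k - l)) = f - l" by (rule ext) simp
    ultimately have "f - l \<in> grad G ` Omega0 G" by (simp only:)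
    then show "(f, l) \<in> cohomologous" using fk kl unfolding cohomologous_def by blast
  qed
qed

lemma H1_quotient: "H1 G = Omega1 G // cohomologous"
  by (simp add: H1_def cohomologous_def)

lemma pull1_cohomologous:
  assumes "g \<in> automorphisms G" "(f, k) \<in> cohomologous"
  shows "(pull1 G g f, pull1 G g k) \<in> cohomologous"
  using assms pull1_Omega1 pull1_exact[OF assms(1), of "f - k"]
  unfolding cohomologous_def pull1_diff by blast

text \<open>The second inclusion comes from pulling back along the inverse automorphism.\<close>

lemma pull1_image_coset:
  assumes g: "g \<in> automorphisms G" and f: "f \<in> Omega1 G"
  shows "pull1 G g ` (cohomologous `` {f}) = cohomologous `` {pull1 G g f}"
proof
  show "pull1 G g ` (cohomologous `` {f}) \<subseteq> cohomologous `` {pull1 G g f}"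
    using pull1_cohomologous[OF g] by blast
  interpret A: group "Aut G" by (rule group_Aut)
  let ?i = "inv\<^bsub>Aut G\<^esub> g"
  have gA: "g \<in> carrier (Aut G)" using g by (simp add: carrier_Aut)
  have i: "?i \<in> automorphisms G" using A.inv_closed[OF gA] by (simp add: carrier_Aut)
  have inv: "pull1 G ?i (pull1 G g k) = k" "pull1 G g (pull1 G ?i k) = k" if "k \<in> Omega1 G" for k
    using pull1_mult[OF g i, of k] pull1_mult[OF i g, of k] pull1_one[OF that] gA by simp_all
  show "cohomologous `` {pull1 G g f} \<subseteq> pull1 G g ` (cohomologous `` {f})"
  proof
    fix k assume "k \<in> cohomologous `` {pull1 G g f}"
    then have k: "(pull1 G g f, k) \<in> cohomologous" "k \<in> Omega1 G" by (auto simp: cohomologous_def)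
    have "(f, pull1 G ?i k) \<in> cohomologous" using pull1_cohomologous[OF i k(1)] inv(1)[OF f] by simp
    then show "k \<in> pull1 G g ` (cohomologous `` {f})" using inv(2)[OF k(2)] by (metis Image_singleton_iff image_eqI)
  qed
qed

lemma phi1_action:
  shows phi1_hom: "phi1 G \<in> hom (Aut G) (BijGroup (H1 G))"
    and phi1_eq_one_iff_cosets: "g \<in> automorphisms G \<Longrightarrow>
      phi1 G g = \<one>\<^bsub>BijGroup (H1 G)\<^esub> \<longleftrightarrow> (\<forall>c\<in>H1 G. pull1 G g ` c = c)"
proof -
  have sub: "c \<subseteq> Omega1 G" if "c \<in> H1 G" for c
    using that unfolding H1_quotient quotient_def cohomologous_def by blast
  have closed: "pull1 G g ` c \<in> H1 G" if "g \<in> carrier (Aut G)" "c \<in> H1 G" for g c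
  proof -
    have g: "g \<in> automorphisms G" using that(1) by (simp add: carrier_Aut)
    obtain f where f: "c = cohomologous `` {f}" "f \<in> Omega1 G"
      using \<open>c \<in> H1 G\<close> unfolding H1_quotient by (rule quotientE)
    show ?thesis
      unfolding f(1) pull1_image_coset[OF g f(2)] H1_quotient by (rule quotientI[OF pull1_Omega1[OF g f(2)]])
  qed
  have one: "pull1 G \<one>\<^bsub>Aut G\<^esub> ` c = c" if "c \<in> H1 G" for c
    using pull1_one sub[OF that] by (force simp: image_iff)
  have mult: "pull1 G (g \<otimes>\<^bsub>Aut G\<^esub> h) ` c = pull1 G h ` (pull1 G g ` c)"
    if "g \<in> carrier (Aut G)" "h \<in> carrier (Aut G)" "c \<in> H1 G" for g h c
    using pull1_mult that by (simp add: carrier_Aut image_image)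
  have \<phi>: "phi1 G = (\<lambda>g. inv\<^bsub>BijGroup (H1 G)\<^esub> (\<lambda>c\<in>H1 G. pull1 G g ` c))"
    by (rule ext) (simp add: phi1_def)
  show "phi1 G \<in> hom (Aut G) (BijGroup (H1 G))"
    unfolding \<phi> by (rule inv_right_action(1)
      [where act = "\<lambda>g. (`) (pull1 G g)" and A = "Aut G", OF group_Aut closed one mult])
  show "phi1 G g = \<one>\<^bsub>BijGroup (H1 G)\<^esub> \<longleftrightarrow> (\<forall>c\<in>H1 G. pull1 G g ` c = c)"
    if "g \<in> automorphisms G"
    unfolding \<phi> by (rule inv_right_action(2)
      [where act = "\<lambda>g. (`) (pull1 G g)" and A = "Aut G", OF group_Aut closed one mult])
      (simp_all add: that carrier_Aut)
qed

lemma phi1_eq_one_iff: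
  assumes g: "g \<in> automorphisms G"
  shows "phi1 G g = \<one>\<^bsub>BijGroup (H1 G)\<^esub> \<longleftrightarrow>
    (\<forall>f\<in>Omega1 G. f - pull1 G g f \<in> grad G ` Omega0 G)"
proof -
  have "(\<forall>c\<in>H1 G. pull1 G g ` c = c) \<longleftrightarrow>
    (\<forall>f\<in>Omega1 G. pull1 G g ` (cohomologous `` {f}) = cohomologous `` {f})"
    unfolding H1_quotient by (auto simp: quotient_def)
  also have "\<dots> \<longleftrightarrow> (\<forall>f\<in>Omega1 G. (f, pull1 G g f) \<in> cohomologous)"
    using pull1_image_coset[OF g] pull1_Omega1[OF g] eq_equiv_class_iff[OF equiv_cohomologous]
    by metis
  also have "\<dots> \<longleftrightarrow> (\<forall>f\<in>Omega1 G. f - pull1 G g f \<in> grad G ` Omega0 G)"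
    using pull1_Omega1[OF g] by (auto simp: cohomologous_def)
  finally show ?thesis by (simp only: phi1_eq_one_iff_cosets[OF g])
qed

text \<open>The divergence of the pullback at \<open>v\<close> is that of \<open>k\<close> at
  \<open>g v\<close>.\<close>

lemma pull1_flow:
  assumes g: "g \<in> automorphisms G" and k: "k \<in> flows G"
  shows "pull1 G g k \<in> flows G"
proof -
  have k1: "k \<in> Omega1 G" using k by (rule flows_Omega1)
  have p1: "pull1 G g k \<in> Omega1 G" by (rule pull1_Omega1[OF g k1])
  have "divg G (pull1 G g k) v = 0" for v
  proof (cases "v \<in> pverts G")
    case True
    have "divg G (pull1 G g k) v = (\<Sum>w\<in>pverts G. k (g v, g w))"
      unfolding divg_def by (rule sum.cong) (simp_all add: pull1_apply[OF g k1 True])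
    also have "\<dots> = divg G k (g v)"
      unfolding divg_def by (rule sum.reindex_bij_betw[OF automorphisms_bij[OF g]])
    finally show ?thesis using k by (simp add: flows_def)
  qed (rule divg_outside[OF p1])
  then show ?thesis using p1 by (simp add: flows_def)
qed

lemma form_inner_automorphism:
  assumes "g \<in> automorphisms G"
  shows "(\<Sum>v\<in>pverts G. \<Sum>w\<in>pverts G. f (g v, g w) * k (g v, g w)) = form_inner G f k"
proof -
  note bij = automorphisms_bij[OF assms]
  have "(\<Sum>v\<in>pverts G. \<Sum>w\<in>pverts G. f (g v, g w) * k (g v, g w)) =
    (\<Sum>v\<in>pverts G. \<Sum>w\<in>pverts G. f (g v, w) * k (g v, w))"
    by (rule sum.cong[OF refl], rule sum.reindex_bij_betw[OF bij])
  also have "\<dots> = (\<Sum>v\<in>pverts G. \<Sum>w\<in>pverts G. f (v, w) * k (v, w))"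
    by (rule sum.reindex_bij_betw[OF bij])
  finally show ?thesis by (simp add: form_inner_def)
qed

end

section \<open>The kernel of \<open>phi1\<close>\<close>

context betti2_graph
begin

lemma phi1_kernel:
  assumes g: "g \<in> automorphisms G"
  shows "phi1 G g = \<one>\<^bsub>BijGroup (H1 G)\<^esub> \<longleftrightarrow> (\<forall>v\<in>pverts (Cyc G). g v = v)"
proof
  assume "phi1 G g = \<one>\<^bsub>BijGroup (H1 G)\<^esub>"
  then have ex: "f - pull1 G g f \<in> grad G ` Omega0 G" if "f \<in> Omega1 G" for f
    using phi1_eq_one_iff[OF g] that by blast
  have "h (g v, g w) = h (v, w)" if h: "h \<in> flows G" and V: "v \<in> pverts G" "w \<in> pverts G" for h v w
  proof -
    have h1: "h \<in> Omega1 G" using h by (rule flows_Omega1)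
    obtain u where u: "h - pull1 G g h = grad G u" using ex[OF h1] by blast
    \<comment> \<open>The difference is both exact and a flow, hence orthogonal to itself and
      zero.\<close>
    have d: "h - pull1 G g h \<in> flows G" by (rule flows_diff[OF h pull1_flow[OF g h]])
    then have "form_inner G (h - pull1 G g h) (h - pull1 G g h) = 0"
      using form_inner_grad_flow[OF d, of u] by (simp only: u)
    with flows_Omega1[OF d] have "h - pull1 G g h = 0" by (rule form_inner_self_eq_0)
    then have "pull1 G g h = h" by (simp only: right_minus_eq)
    then show ?thesis using pull1_apply[OF g h1 V] by simp
  qed
  then show "\<forall>v\<in>pverts (Cyc G). g v = v" using flow_invariant_fixes_Cyc[OF g] by blast
next
  assume fix_Cyc: "\<forall>v\<in>pverts (Cyc G). g v = v"
  \<comment> \<open>On core pairs \<open>g\<close> is the identity. Any other pair has an end off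
    the core, its image does too, and flows vanish on both.\<close>
  have inv: "k (g v, g w) = k (v, w)"
    if k: "k \<in> flows G" and V: "v \<in> pverts G" "w \<in> pverts G" for k v w
  proof (cases "v \<in> pverts (Cyc G) \<and> w \<in> pverts (Cyc G)")
    case False
    then have "\<not> (g v \<in> pverts (Cyc G) \<and> g w \<in> pverts (Cyc G))"
      using V forest_verts_automorphism[OF g parcs_subset] by (simp add: pverts_Cyc)
    then show ?thesis using False flow_support_in_Cyc[OF k] by metis
  qed (use fix_Cyc in simp)
  have "f - pull1 G g f \<in> grad G ` Omega0 G" if f: "f \<in> Omega1 G" for f
  proof (rule exact_if_orthogonal_flows[OF reach])
    show "f - pull1 G g f \<in> Omega1 G" by (intro Omega1_diff pull1_Omega1 f g)
    fix k assume k: "k \<in> flows G"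
    \<comment> \<open>Since \<open>k\<close> is invariant, both factors can be evaluated at the
      image pair; reindexing by \<open>g\<close> then gives the inner product of \<open>f\<close>
      and \<open>k\<close>.\<close>
    have "form_inner G (pull1 G g f) k =
      (\<Sum>v\<in>pverts G. \<Sum>w\<in>pverts G. f (g v, g w) * k (g v, g w))"
      unfolding form_inner_def
      by (intro sum.cong[OF refl]) (simp add: pull1_apply[OF g f] inv[OF k])
    then show "form_inner G (f - pull1 G g f) k = 0"
      using form_inner_automorphism[OF g, of f k] by (simp add: form_inner_diff_left)
  qed
  then show "phi1 G g = \<one>\<^bsub>BijGroup (H1 G)\<^esub>" using phi1_eq_one_iff[OF g] by blast
qed

text \<open>The kernel criterion applied to the inverse of \<open>h\<close> times \<open>g\<close>.
  Thus \<open>phi1\<close> records precisely what an automorphism does on the core.\<close>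

lemma phi1_eq_iff:
  assumes g: "g \<in> automorphisms G" and h: "h \<in> automorphisms G"
  shows "phi1 G g = phi1 G h \<longleftrightarrow> (\<forall>v\<in>pverts (Cyc G). g v = h v)"
proof -
  interpret A: group "Aut G" by (rule group_Aut)
  interpret B: group "BijGroup (H1 G)" by (rule group_BijGroup)
  interpret \<phi>: group_hom "Aut G" "BijGroup (H1 G)" "phi1 G"
    by unfold_locales (rule phi1_hom)
  define k where "k = inv\<^bsub>Aut G\<^esub> h \<otimes>\<^bsub>Aut G\<^esub> g"
  have gA: "g \<in> carrier (Aut G)" and hA: "h \<in> carrier (Aut G)" using g h by (auto simp: carrier_Aut)
  have kA: "k \<in> carrier (Aut G)" using gA hA by (simp add: k_def)
  then have k: "k \<in> automorphisms G" by (simp add: carrier_Aut)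
  have hk: "h \<otimes>\<^bsub>Aut G\<^esub> k = g" using gA hA by (simp add: k_def flip: A.m_assoc)
  have "phi1 G g = phi1 G h \<otimes>\<^bsub>BijGroup (H1 G)\<^esub> phi1 G k"
    using \<phi>.hom_mult[OF hA kA] hk by simp
  then have "phi1 G g = phi1 G h \<longleftrightarrow> phi1 G k = \<one>\<^bsub>BijGroup (H1 G)\<^esub>"
    using B.l_cancel_one[OF \<phi>.hom_closed[OF hA] \<phi>.hom_closed[OF kA]] by simp
  also have "\<dots> \<longleftrightarrow> (\<forall>v\<in>pverts (Cyc G). k v = v)" by (rule phi1_kernel[OF k])
  also have "\<dots> \<longleftrightarrow> (\<forall>v\<in>pverts (Cyc G). g v = h v)"
  proof -
    have "k v = v \<longleftrightarrow> g v = h v" if "v \<in> pverts G" for v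
    proof -
      have "g v = h (k v)" using mult_Aut_apply[OF h k that] hk by simp
      then show ?thesis
        using automorphisms_bij[OF h] automorphisms_closed[OF k that] that
        by (auto simp: bij_betw_def dest: inj_onD)
    qed
    then show ?thesis by (auto simp: pverts_Cyc)
  qed
  finally show ?thesis .
qed

end

section \<open>The splitting\<close>

text \<open>Vertices shared by \<open>Forest X\<close> and \<open>Cyc X\<close> fall under
  \<open>b\<close>.\<close>

definition glue :: "'a pair_pre_digraph \<Rightarrow> ('a \<Rightarrow> 'a) \<Rightarrow> ('a \<Rightarrow> 'a) \<Rightarrow> 'a \<Rightarrow> 'a" where
  "glue X a b = (\<lambda>v\<in>pverts X. if v \<in> forest_verts X then a v else b v)"

lemma pverts_Forest: "pverts (Forest X) = forest_verts X \<union> {w. \<exists>v \<in> forest_verts X. (v, w) \<in> parcs X}"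
  by (simp add: Forest_def)

lemma parcs_Forest:
  "(v, w) \<in> parcs (Forest X) \<longleftrightarrow> (v, w) \<in> parcs X \<and> (v \<in> forest_verts X \<or> w \<in> forest_verts X)"
  by (simp add: Forest_def)

context pair_graph
begin

lemma pverts_Forest_subset: "pverts (Forest G) \<subseteq> pverts G"
  using forest_verts_subset[of G] parcs_subset by (auto simp: pverts_Forest)

lemma parcs_Forest_subset: "parcs (Forest G) \<subseteq> pverts (Forest G) \<times> pverts (Forest G)"
proof (rule subrelI)
  show "(v, w) \<in> pverts (Forest G) \<times> pverts (Forest G)" if "(v, w) \<in> parcs (Forest G)" for v w
    using that arcs_symmetric[of v w] unfolding parcs_Forest pverts_Forest by blast
qed

text \<open>\<open>HH0 (Forest G)\<close> is formed from automorphisms of the forest, so its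
  triviality bears on \<open>g\<close> through this restriction.\<close>

lemma restrict_automorphism_Forest:
  assumes g: "g \<in> automorphisms G"
  shows "restrict g (pverts (Forest G)) \<in> automorphisms (Forest G)"
proof (rule automorphismsI)
  let ?F = "pverts (Forest G)"
  have inF: "g v \<in> forest_verts G \<longleftrightarrow> v \<in> forest_verts G" if "v \<in> pverts G" for v
    using forest_verts_automorphism[OF g parcs_subset that] .
  have "g ` ?F \<subseteq> ?F"
  proof
    fix y assume "y \<in> g ` ?F"
    then obtain w where w: "w \<in> ?F" "y = g w" by blast
    have V: "w \<in> pverts G" using w(1) pverts_Forest_subset by blast
    show "y \<in> ?F"
    proof (cases "w \<in> forest_verts G")
      case True
      then show ?thesis using inF[OF V] w by (simp add: pverts_Forest)
    next
      case False
      then obtain v where v: "v \<in> forest_verts G" "(v, w) \<in> parcs G" using w by (auto simp: pverts_Forest)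
      have "v \<in> pverts G" using v forest_verts_subset[of G] by blast
      then have "(g v, g w) \<in> parcs G" "g v \<in> forest_verts G"
        using automorphisms_adj[OF g _ V] inF v by auto
      then show ?thesis using w by (auto simp: pverts_Forest)
    qed
  qed
  moreover have "inj_on g ?F"
    using automorphisms_bij[OF g] pverts_Forest_subset by (meson bij_betw_def inj_on_subset)
  moreover have "finite ?F" using pverts_Forest_subset pair_finite_verts by (rule finite_subset)
  ultimately have "bij_betw g ?F ?F" by (simp add: bij_betw_def endo_inj_surj)
  then show "bij_betw (restrict g ?F) ?F ?F" by simp
  fix v w assume "v \<in> ?F" "w \<in> ?F"
  moreover from this have "v \<in> pverts G" "w \<in> pverts G" using pverts_Forest_subset by auto
  ultimately show "(restrict g ?F v, restrict g ?F w) \<in> parcs (Forest G) \<longleftrightarrow> (v, w) \<in> parcs (Forest G)"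
    using inF automorphisms_adj[OF g] by (simp add: parcs_Forest)
qed simp

text \<open>
  A component of the forest meets the core in a single vertex: a unit flow in the forest between two
  core vertices would be supported in the core.
\<close>

lemma Forest_component_root_unique:
  assumes "(r, s) \<in> (parcs (Forest G))\<^sup>*" and r: "r \<in> pverts (Cyc G)" and s: "s \<in> pverts (Cyc G)"
  shows "r = s"
proof -
  have sub: "parcs (Forest G) \<subseteq> parcs G" by (auto simp: Forest_def)
  have sym: "sym (parcs (Forest G))"
    by (rule symI) (use arcs_symmetric in \<open>auto simp: parcs_Forest\<close>)
  obtain k where k: "k \<in> Omega1 G" "\<forall>e. k e \<noteq> 0 \<longrightarrow> e \<in> parcs (Forest G)"
    "\<forall>v. divg G k v = of_bool (v = r) - of_bool (v = s)"
    using unit_flow_exists[OF assms(1) sub sym] by blast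
  have "divg G k v = 0" if "v \<in> forest_verts G" for v
    using that r s by (auto simp: k(3) pverts_Cyc)
  then have "k (v, w) = 0" for v w
    using support_in_Cyc[OF k(1), of v w] k(2) by (auto simp: parcs_Forest pverts_Cyc)
  then have "divg G k r = 0" by (simp add: divg_def)
  then show ?thesis using k(3) by (simp add: of_bool_def split: if_splits)
qed

text \<open>Triviality leaves the indicator function of the forest component of \<open>r\<close>
  invariant, so \<open>g r\<close> stays in that component. It is also a core vertex, and the
  component has only one.\<close>

lemma roots_fixed:
  assumes triv: "trivial_group (HH0 (Forest G))" and g: "g \<in> automorphisms G"
    and r: "r \<in> pverts (Forest G)" "r \<in> pverts (Cyc G)"
  shows "g r = r"
proof -
  let ?F = "Forest G"
  let ?g = "restrict g (pverts ?F)"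
  have g': "?g \<in> automorphisms ?F" by (rule restrict_automorphism_Forest[OF g])
  have "phi0 ?F ?g \<in> carrier (HH0 ?F)" using g' by (simp add: HH0_def carrier_Aut)
  also have "carrier (HH0 ?F) = {\<one>\<^bsub>BijGroup (H0 ?F)\<^esub>}"
    using triv by (simp add: trivial_group_def HH0_def)
  finally have inv: "pull0 ?F ?g u = u" if "u \<in> H0 ?F" for u
    using phi0_eq_one_iff[OF parcs_Forest_subset g'] that by blast
  define u where "u v = (of_bool (v \<in> pverts ?F \<and> (r, v) \<in> (parcs ?F)\<^sup>*) :: real)" for v
  have "u v = u w" if vw: "(v, w) \<in> parcs ?F" for v w
  proof -
    have "(w, v) \<in> parcs ?F" using vw arcs_symmetric[of v w] by (auto simp: parcs_Forest)
    then have "(r, v) \<in> (parcs ?F)\<^sup>* \<longleftrightarrow> (r, w) \<in> (parcs ?F)\<^sup>*"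
      using vw by (meson rtrancl_into_rtrancl)
    then show ?thesis using vw parcs_Forest_subset by (auto simp: u_def)
  qed
  moreover have "u \<in> Omega0 ?F" by (simp add: Omega0_def u_def)
  ultimately have "u \<in> H0 ?F" unfolding H0_arcs[OF parcs_Forest_subset] by blast
  then have "pull0 ?F ?g u r = u r" by (simp only: inv)
  then have "u (g r) = u r" using r(1) by (simp add: pull0_def)
  then have "(r, g r) \<in> (parcs ?F)\<^sup>*" using r(1) by (simp add: u_def split: if_splits)
  moreover have "g r \<in> pverts (Cyc G)"
    using r(2) forest_verts_automorphism[OF g parcs_subset] automorphisms_closed[OF g]
    by (simp add: pverts_Cyc)
  ultimately show ?thesis using Forest_component_root_unique r(2) by metis
qed

lemma glue_apply:
  "v \<in> pverts G \<Longrightarrow> glue G a b v = (if v \<in> forest_verts G then a v else b v)"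
  by (simp add: glue_def)

text \<open>Only arcs between a forest vertex and a core vertex mix the two maps, and the core end
  of such an arc is fixed by both.\<close>

lemma glue_automorphism:
  assumes triv: "trivial_group (HH0 (Forest G))"
    and a: "a \<in> automorphisms G" and b: "b \<in> automorphisms G"
  shows "glue G a b \<in> automorphisms G"
proof (rule automorphismsI)
  let ?V = "pverts G" and ?F = "forest_verts G" and ?g = "glue G a b"
  note inF = forest_verts_automorphism[OF a parcs_subset] forest_verts_automorphism[OF b parcs_subset]
  note V = automorphisms_closed[OF a] automorphisms_closed[OF b]
  note inj = automorphisms_bij[OF a, THEN bij_betw_imp_inj_on]
    automorphisms_bij[OF b, THEN bij_betw_imp_inj_on]
  show "?g \<in> extensional ?V" by (simp add: glue_def)
  have gF: "?g v \<in> ?F \<longleftrightarrow> v \<in> ?F" if "v \<in> ?V" for v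
    using inF that by (simp add: glue_apply)
  have "inj_on ?g ?V"
  proof (rule inj_onI)
    fix v w assume vw: "v \<in> ?V" "w \<in> ?V" "?g v = ?g w"
    then have "v \<in> ?F \<longleftrightarrow> w \<in> ?F" using gF by metis
    then show "v = w" using vw inj by (auto simp: glue_apply dest: inj_onD split: if_splits)
  qed
  moreover have "?g ` ?V \<subseteq> ?V" using V by (auto simp: glue_apply)
  ultimately show "bij_betw ?g ?V ?V"
    using endo_inj_surj[OF pair_finite_verts] by (simp add: bij_betw_def)
  have mixed: "(a v, b w) \<in> parcs G \<longleftrightarrow> (v, w) \<in> parcs G"
    if v: "v \<in> ?V" "v \<in> ?F" and w: "w \<in> ?V" "w \<notin> ?F" for v w
  proof -
    have fix_root: "a x = x \<and> b x = x" if "(y, x) \<in> parcs G" "y \<in> ?F" "x \<in> ?V" "x \<notin> ?F" for x y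
      using that roots_fixed[OF triv a, of x] roots_fixed[OF triv b, of x]
      by (auto simp: pverts_Forest pverts_Cyc)
    have "a w = w" "b w = w" if "(v, w) \<in> parcs G" using fix_root[OF that v(2) w] by auto
    \<comment> \<open>In this direction it is \<open>b w\<close> that is known to be a fixed shared
      vertex; injectivity of \<open>b\<close> then gives \<open>b w = w\<close>.\<close>
    moreover have "a w = w" "b w = w" if avbw: "(a v, b w) \<in> parcs G"
    proof -
      have "a v \<in> ?F" "b w \<in> ?V" "b w \<notin> ?F" using v w inF V by auto
      then have "a (b w) = b w" "b (b w) = b w" using fix_root[OF avbw] by auto
      then show "a w = w" "b w = w" using inj_onD[OF inj(2)] V w by metis+
    qed
    ultimately show ?thesis using automorphisms_adj[OF a v(1) w(1)] by metis
  qed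
  fix v w assume v: "v \<in> ?V" and w: "w \<in> ?V"
  have sym: "(x, y) \<in> parcs G \<longleftrightarrow> (y, x) \<in> parcs G" for x y using arcs_symmetric by blast
  show "(?g v, ?g w) \<in> parcs G \<longleftrightarrow> (v, w) \<in> parcs G"
  proof (cases "v \<in> ?F"; cases "w \<in> ?F")
    assume "v \<notin> ?F" "w \<in> ?F"
    then show ?thesis
      using mixed[OF w _ v] v w sym[of v w] sym[of "b v" "a w"] by (simp add: glue_apply)
  qed (use v w mixed automorphisms_adj[OF a v w] automorphisms_adj[OF b v w] in \<open>simp_all add: glue_apply\<close>)
qed

end

section \<open>The product decomposition\<close>

context betti2_graph
begin

lemma carrier_Ker1: "carrier (Ker1 G) = fixing G (pverts (Cyc G))"
  using phi1_kernel by (auto simp: Ker1_def kernel_def carrier_Aut fixing_def)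

text \<open>An automorphism fixing the forest is determined by its action on the core, which
  \<open>phi1\<close> records; surjectivity comes from gluing.\<close>

lemma phi1_split_iso:
  assumes triv: "trivial_group (HH0 (Forest G))"
  shows "phi1 G \<in> iso (Aut G \<lparr>carrier := fixing G (pverts (Forest G))\<rparr>) (HH1 G)"
proof (rule isoI)
  let ?M = "fixing G (pverts (Forest G))"
  let ?e = "\<lambda>v\<in>pverts G. v"
  have M: "g \<in> automorphisms G" if "g \<in> ?M" for g using that by (simp add: fixing_def)
  show "phi1 G \<in> hom (Aut G \<lparr>carrier := ?M\<rparr>) (HH1 G)"
    using phi1_hom M by (auto simp: hom_def HH1_def carrier_Aut)
  have "inj_on (phi1 G) ?M"
  proof (rule inj_onI)
    fix g h assume gh: "g \<in> ?M" "h \<in> ?M" "phi1 G g = phi1 G h"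
    show "g = h"
    proof (rule automorphisms_eqI[OF M[OF gh(1)] M[OF gh(2)]])
      fix v assume "v \<in> pverts G"
      then show "g v = h v"
        using gh phi1_eq_iff[OF M[OF gh(1)] M[OF gh(2)]]
        by (cases "v \<in> forest_verts G") (auto simp: fixing_def pverts_Forest pverts_Cyc)
    qed
  qed
  moreover have "phi1 G g \<in> phi1 G ` ?M" if g: "g \<in> automorphisms G" for g
  proof -
    \<comment> \<open>Keep \<open>g\<close> on the core and replace it by the identity on the
      forest: the value of \<open>phi1\<close> is unchanged.\<close>
    let ?m = "glue G ?e g"
    have m: "?m \<in> automorphisms G" by (rule glue_automorphism[OF triv id_automorphism g])
    have "?m v = v" if v: "v \<in> pverts (Forest G)" for v
    proof -
      have "v \<in> pverts G" using v pverts_Forest_subset by blast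
      then show ?thesis using roots_fixed[OF triv g v] by (simp add: glue_apply pverts_Cyc)
    qed
    then have "?m \<in> ?M" using m by (simp add: fixing_def)
    moreover have "phi1 G g = phi1 G ?m"
      unfolding phi1_eq_iff[OF g m] by (simp add: glue_apply pverts_Cyc)
    ultimately show ?thesis by blast
  qed
  ultimately show "bij_betw (phi1 G) (carrier (Aut G \<lparr>carrier := ?M\<rparr>)) (carrier (HH1 G))"
    using M by (auto simp: bij_betw_def HH1_def carrier_Aut)
qed

text \<open>The first component of \<open>\<Psi> g\<close> keeps the forest part of
  \<open>g\<close>, extended by the identity on the core; the second records its core part.\<close>

lemma splitting_iso:
  assumes triv: "trivial_group (HH0 (Forest G))"
  defines "\<Psi> \<equiv> \<lambda>g. (glue G g (\<lambda>v\<in>pverts G. v), phi1 G g)"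
  shows "\<Psi> \<in> iso (Aut G) (Ker1 G \<times>\<times> HH1 G)"
    and "g \<in> fixing G (pverts (Cyc G)) \<Longrightarrow> \<Psi> g = (g, \<one>\<^bsub>HH1 G\<^esub>)"
    and "g \<in> fixing G (pverts (Forest G)) \<Longrightarrow> \<Psi> g = (\<one>\<^bsub>Ker1 G\<^esub>, phi1 G g)"
proof -
  let ?e = "\<lambda>v\<in>pverts G. v"
  have glue_Ker: "glue G g ?e \<in> fixing G (pverts (Cyc G))" if "g \<in> automorphisms G" for g
    using glue_automorphism[OF triv that id_automorphism]
    by (simp add: fixing_def glue_apply pverts_Cyc)
  have glue_fix: "glue G g ?e = g" if fix_g: "g \<in> fixing G (pverts (Cyc G))" for g
  proof (rule automorphisms_eqI)
    show "glue G g ?e \<in> automorphisms G" "g \<in> automorphisms G"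
      using glue_Ker[of g] fix_g by (simp_all add: fixing_def)
    show "glue G g ?e v = g v" if v: "v \<in> pverts G" for v
      using fix_g v by (simp add: fixing_def glue_apply pverts_Cyc)
  qed
  show "\<Psi> \<in> iso (Aut G) (Ker1 G \<times>\<times> HH1 G)"
  proof (rule isoI)
    show "\<Psi> \<in> hom (Aut G) (Ker1 G \<times>\<times> HH1 G)"
    proof (rule homI)
      fix g assume "g \<in> carrier (Aut G)"
      then show "\<Psi> g \<in> carrier (Ker1 G \<times>\<times> HH1 G)"
        using glue_Ker by (simp add: \<Psi>_def carrier_Ker1 carrier_Aut HH1_def)
    next
      fix g h assume gh: "g \<in> carrier (Aut G)" "h \<in> carrier (Aut G)"
      then have g: "g \<in> automorphisms G" and h: "h \<in> automorphisms G" by (auto simp: carrier_Aut)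
      note n = glue_Ker[OF g, unfolded fixing_def, simplified, THEN conjunct1]
        glue_Ker[OF h, unfolded fixing_def, simplified, THEN conjunct1]
        glue_Ker[OF mult_Aut_closed[OF g h], unfolded fixing_def, simplified, THEN conjunct1]
      \<comment> \<open>Gluing respects products because \<open>h\<close> maps forest vertices to
        forest vertices and core vertices to core vertices.\<close>
      have "glue G (g \<otimes>\<^bsub>Aut G\<^esub> h) ?e = glue G g ?e \<otimes>\<^bsub>Aut G\<^esub> glue G h ?e"
      proof (rule automorphisms_eqI[OF n(3) mult_Aut_closed[OF n(1,2)]])
        fix v assume v: "v \<in> pverts G"
        then show "glue G (g \<otimes>\<^bsub>Aut G\<^esub> h) ?e v = (glue G g ?e \<otimes>\<^bsub>Aut G\<^esub> glue G h ?e) v"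
          using automorphisms_closed[OF h v] forest_verts_automorphism[OF h parcs_subset v]
          by (simp add: mult_Aut_apply[OF n(1,2)] mult_Aut_apply[OF g h] glue_apply)
      qed
      then show "\<Psi> (g \<otimes>\<^bsub>Aut G\<^esub> h) = \<Psi> g \<otimes>\<^bsub>Ker1 G \<times>\<times> HH1 G\<^esub> \<Psi> h"
        using hom_mult[OF phi1_hom gh] by (simp add: \<Psi>_def Ker1_def HH1_def)
    qed
    have "inj_on \<Psi> (automorphisms G)"
    proof (rule inj_onI)
      fix g h assume g: "g \<in> automorphisms G" and h: "h \<in> automorphisms G" and eq: "\<Psi> g = \<Psi> h"
      show "g = h"
      proof (rule automorphisms_eqI[OF g h])
        fix v assume v: "v \<in> pverts G"
        have "glue G g ?e v = glue G h ?e v" using eq by (simp add: \<Psi>_def)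
        moreover have "\<forall>v\<in>pverts (Cyc G). g v = h v"
          using eq phi1_eq_iff[OF g h] by (simp add: \<Psi>_def)
        ultimately show "g v = h v"
          using v by (cases "v \<in> forest_verts G") (auto simp: glue_apply pverts_Cyc)
      qed
    qed
    moreover have "\<Psi> ` automorphisms G = fixing G (pverts (Cyc G)) \<times> phi1 G ` automorphisms G"
    proof
      show "\<Psi> ` automorphisms G \<subseteq> fixing G (pverts (Cyc G)) \<times> phi1 G ` automorphisms G"
        using glue_Ker by (auto simp: \<Psi>_def)
      show "fixing G (pverts (Cyc G)) \<times> phi1 G ` automorphisms G \<subseteq> \<Psi> ` automorphisms G"
      proof clarify
        fix n g assume n: "n \<in> fixing G (pverts (Cyc G))" and g: "g \<in> automorphisms G"
        have nA: "n \<in> automorphisms G" using n by (simp add: fixing_def)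
        \<comment> \<open>The preimage of \<open>(n, phi1 G g)\<close>: forest part from
          \<open>n\<close>, core part from \<open>g\<close>.\<close>
        have ng: "glue G n g \<in> automorphisms G" by (rule glue_automorphism[OF triv nA g])
        have "glue G (glue G n g) ?e = glue G n ?e" by (auto simp: glue_def restrict_def fun_eq_iff)
        moreover have "phi1 G (glue G n g) = phi1 G g"
          unfolding phi1_eq_iff[OF ng g] by (simp add: glue_apply pverts_Cyc)
        ultimately have "\<Psi> (glue G n g) = (n, phi1 G g)" using glue_fix[OF n] by (simp add: \<Psi>_def)
        then show "(n, phi1 G g) \<in> \<Psi> ` automorphisms G" using ng by (metis image_eqI)
      qed
    qed
    ultimately show "bij_betw \<Psi> (carrier (Aut G)) (carrier (Ker1 G \<times>\<times> HH1 G))"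
      by (simp add: bij_betw_def carrier_Aut carrier_Ker1 HH1_def)
  qed
  show "\<Psi> g = (g, \<one>\<^bsub>HH1 G\<^esub>)" if "g \<in> fixing G (pverts (Cyc G))"
    using that glue_fix phi1_kernel by (simp add: \<Psi>_def HH1_def fixing_def)
  show "\<Psi> g = (\<one>\<^bsub>Ker1 G\<^esub>, phi1 G g)" if "g \<in> fixing G (pverts (Forest G))"
    using that by (auto simp: \<Psi>_def Ker1_def one_Aut glue_def fixing_def pverts_Forest fun_eq_iff)
qed

end

theorem theorem3p15:
  fixes \<Gamma> :: "'a pair_pre_digraph"
  assumes "pair_graph \<Gamma>"
    and "connected (with_proj \<Gamma>)"
    and "betti1 \<Gamma> \<ge> 2"
    and "trivial_group (HH0 (Forest \<Gamma>))"
  shows "carrier (Ker1 \<Gamma>) = fixing \<Gamma> (pverts (Cyc \<Gamma>)) \<and>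
    phi1 \<Gamma> \<in> iso (Aut \<Gamma> \<lparr> carrier := fixing \<Gamma> (pverts (Forest \<Gamma>)) \<rparr>) (HH1 \<Gamma>) \<and>
    (\<exists>\<Psi> \<in> iso (Aut \<Gamma>) (Ker1 \<Gamma> \<times>\<times> HH1 \<Gamma>).
       (\<forall>g \<in> fixing \<Gamma> (pverts (Cyc \<Gamma>)). \<Psi> g = (g, \<one>\<^bsub>HH1 \<Gamma>\<^esub>)) \<and>
       (\<forall>g \<in> fixing \<Gamma> (pverts (Forest \<Gamma>)). \<Psi> g = (\<one>\<^bsub>Ker1 \<Gamma>\<^esub>, phi1 \<Gamma> g)))"
proof -
  interpret pair_graph \<Gamma> by fact
  interpret betti2_graph \<Gamma>
  proof
    fix x y assume "x \<in> pverts \<Gamma>" "y \<in> pverts \<Gamma>"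
    \<comment> \<open>\<open>connected\<close> refers to the symmetric closure, which here has the
      same arcs as the graph itself.\<close>
    then have "x \<rightarrow>\<^sup>*\<^bsub>with_proj (mk_symmetric (with_proj \<Gamma>))\<^esub> y"
      using assms(2) by (auto simp: connected_def strongly_connected_def mk_symmetric_def)
    moreover have "parcs (mk_symmetric (with_proj \<Gamma>)) = parcs \<Gamma>"
      using arcs_symmetric by (auto simp: mk_symmetric_def)
    ultimately show "(x, y) \<in> (parcs \<Gamma>)\<^sup>*"
      unfolding reachable_def with_proj_simps by (auto dest: rtrancl_on_rtranclI)
  qed (rule assms(3))
  show ?thesis
    by (intro conjI bexI[OF _ splitting_iso(1)] ballI carrier_Ker1 phi1_split_iso
        splitting_iso(2,3) assms(4))
qed

end
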